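(* For every $c\neq \frac{256}{47}$, the orbifold vertex algebra $\left(\mathcal{V}_c^{\otimes 2}\right)^{S_2}$ is strongly generated by $\omega$, $w_4$, $w_6$, $w_8$. For $c=\frac{256}{47}$, the orbifold $\left(\mathcal{V}_{256/47}^{\otimes 2}\right)^{S_2}$ is strongly generated by $\omega$, $w_4$, $w_6$, $w_8$, $w_{10}$.
   Context: $\mathcal{V}_c$ is the universal Virasoro vertex operator algebra of central charge $c$ (generated by a weight-2 vector with field $L(z)=\sum L(n)z^{-n-2}$, $[L(m),L(n)]=(m-n)L(m+n)+\frac{c}{12}(m^3-m)\delta_{m+n,0}$). In $\mathcal{V}_c^{\otimes 2}$, $\omega_i$ is the Virasoro vector of the $i$-th factor with modes $L_i(m)$, and $S_2$ acts by swapping the two tensor factors; $(\cdot)^{S_2}$ denotes the fixed-point subalgebra. Set $\omega=\omega_1+\omega_2$ and, for $k\geq 0$, $w_k=L_1(2-k)L_1(-2)\mathbb{1}+L_2(2-k)L_2(-2)\mathbb{1}$, a vector of conformal weight $k$. A vertex algebra is strongly generated by a set $S$ if it is spanned by normally ordered monomials in the fields of elements of $S$ and their derivatives. *)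

theory Defs
  imports Complex_Main
begin

definition vir_rel :: "(complex \<Rightarrow> 'w::ab_group_add \<Rightarrow> 'w) \<Rightarrow> complex \<Rightarrow> (int \<Rightarrow> 'w \<Rightarrow> 'w) \<Rightarrow> bool" where
  "vir_rel sc c L \<longleftrightarrow>
     (\<forall>m n v. L m (L n v) - L n (L m v) =
        sc (of_int (m - n)) (L (m + n) v)
        + (if m + n = 0 then sc (c / 12 * of_int (m ^ 3 - m)) v else 0))"

definition pbw_index :: "(int list \<times> int list) set" where
  "pbw_index = {(ms, ns). sorted ms \<and> sorted ns \<and> (\<forall>x\<in>set ms. x \<le> -2) \<and> (\<forall>x\<in>set ns. x \<le> -2)}"

definition pbw_mono :: "(int \<Rightarrow> 'w \<Rightarrow> 'w) \<Rightarrow> (int \<Rightarrow> 'w \<Rightarrow> 'w) \<Rightarrow> 'w \<Rightarrow> int list \<times> int list \<Rightarrow> 'w" where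
  "pbw_mono L1 L2 vac = (\<lambda>(ms, ns). foldr L1 ms (foldr L2 ns vac))"

text \<open>(W, sc, vac, L1, L2) is (a model of) V_c tensor V_c: W is the tensor product of
  two copies of the universal Virasoro vacuum module of central charge c, i.e. two commuting
  Virasoro actions of central charge c, vacuum annihilated by L_i(n), n \<ge> -1, and the PBW
  monomials form a basis.  This determines (W, vac, L1, L2) up to isomorphism.\<close>
definition vir_tensor_square ::
  "(complex \<Rightarrow> 'w::ab_group_add \<Rightarrow> 'w) \<Rightarrow> complex \<Rightarrow> 'w \<Rightarrow> (int \<Rightarrow> 'w \<Rightarrow> 'w) \<Rightarrow> (int \<Rightarrow> 'w \<Rightarrow> 'w) \<Rightarrow> bool" where
  "vir_tensor_square sc c vac L1 L2 \<longleftrightarrow>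
     vector_space sc \<and>
     (\<forall>n. Vector_Spaces.linear sc sc (L1 n)) \<and> (\<forall>n. Vector_Spaces.linear sc sc (L2 n)) \<and>
     vir_rel sc c L1 \<and> vir_rel sc c L2 \<and>
     (\<forall>m n v. L1 m (L2 n v) = L2 n (L1 m v)) \<and>
     (\<forall>n. n \<ge> -1 \<longrightarrow> L1 n vac = 0 \<and> L2 n vac = 0) \<and>
     inj_on (pbw_mono L1 L2 vac) pbw_index \<and>
     \<not> module.dependent sc (pbw_mono L1 L2 vac ` pbw_index) \<and>
     module.span sc (pbw_mono L1 L2 vac ` pbw_index) = UNIV"

definition swap_of ::
  "(complex \<Rightarrow> 'w::ab_group_add \<Rightarrow> 'w) \<Rightarrow> 'w \<Rightarrow> (int \<Rightarrow> 'w \<Rightarrow> 'w) \<Rightarrow> (int \<Rightarrow> 'w \<Rightarrow> 'w) \<Rightarrow> ('w \<Rightarrow> 'w) \<Rightarrow> bool" where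
  "swap_of sc vac L1 L2 \<sigma> \<longleftrightarrow>
     Vector_Spaces.linear sc sc \<sigma> \<and> \<sigma> vac = vac \<and>
     (\<forall>n v. \<sigma> (L1 n v) = L2 n (\<sigma> v) \<and> \<sigma> (L2 n v) = L1 n (\<sigma> v))"

text \<open>Modes of a normally ordered product, with the convention a(z) = sum a_(n) z^(-n-1):
  (a_(-j-1) b)_(n) = sum_{i\<ge>0} binom(j+i,i) (a_(-j-1-i) b_(n+i) + (-1)^j b_(n-j-1-i) a_(i)).
  Applied to any vector only finitely many terms are nonzero; we sum over those.\<close>
definition nop_term ::
  "(complex \<Rightarrow> 'w::ab_group_add \<Rightarrow> 'w) \<Rightarrow> (int \<Rightarrow> 'w \<Rightarrow> 'w) \<Rightarrow> (int \<Rightarrow> 'w \<Rightarrow> 'w) \<Rightarrow> nat \<Rightarrow> int \<Rightarrow> 'w \<Rightarrow> nat \<Rightarrow> 'w" where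
  "nop_term sc A B j n v i =
     sc (of_nat ((j + i) choose i))
       (A (- int j - 1 - int i) (B (n + int i) v)
        + sc ((-1) ^ j) (B (n - int j - 1 - int i) (A (int i) v)))"

definition nop ::
  "(complex \<Rightarrow> 'w::ab_group_add \<Rightarrow> 'w) \<Rightarrow> (int \<Rightarrow> 'w \<Rightarrow> 'w) \<Rightarrow> (int \<Rightarrow> 'w \<Rightarrow> 'w) \<Rightarrow> nat \<Rightarrow> int \<Rightarrow> 'w \<Rightarrow> 'w" where
  "nop sc A B j n v = (\<Sum>i\<in>{i. nop_term sc A B j n v i \<noteq> 0}. nop_term sc A B j n v i)"

definition omega_modes :: "(int \<Rightarrow> 'w::ab_group_add \<Rightarrow> 'w) \<Rightarrow> (int \<Rightarrow> 'w \<Rightarrow> 'w) \<Rightarrow> int \<Rightarrow> 'w \<Rightarrow> 'w" where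
  "omega_modes L1 L2 n v = L1 (n - 1) v + L2 (n - 1) v"

text \<open>Modes of w_k = L1(2-k)L1(-2)1 + L2(2-k)L2(-2)1 = (omega_1)_(3-k) omega_1 + (omega_2)_(3-k) omega_2,
  for k \<ge> 4 (so 3-k = -j-1 with j = k-4).\<close>
definition w_modes ::
  "(complex \<Rightarrow> 'w::ab_group_add \<Rightarrow> 'w) \<Rightarrow> (int \<Rightarrow> 'w \<Rightarrow> 'w) \<Rightarrow> (int \<Rightarrow> 'w \<Rightarrow> 'w) \<Rightarrow> nat \<Rightarrow> int \<Rightarrow> 'w \<Rightarrow> 'w" where
  "w_modes sc L1 L2 k n v =
     nop sc (\<lambda>p. L1 (p - 1)) (\<lambda>p. L1 (p - 1)) (k - 4) n v
     + nop sc (\<lambda>p. L2 (p - 1)) (\<lambda>p. L2 (p - 1)) (k - 4) n v"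

text \<open>Normally ordered monomial :d^{n1}a1 ... d^{nk}ak: evaluated on the vacuum is, up to the
  nonzero factor n1!...nk!, the state a1_(-n1-1) ... ak_(-nk-1) 1.\<close>
definition nmono :: "'w \<Rightarrow> ((int \<Rightarrow> 'w \<Rightarrow> 'w) \<times> nat) list \<Rightarrow> 'w" where
  "nmono vac ps = foldr (\<lambda>(a, n) v. a (- int n - 1) v) ps vac"

definition strongly_generated_by ::
  "(complex \<Rightarrow> 'w::ab_group_add \<Rightarrow> 'w) \<Rightarrow> 'w \<Rightarrow> 'w set \<Rightarrow> (int \<Rightarrow> 'w \<Rightarrow> 'w) set \<Rightarrow> bool" where
  "strongly_generated_by sc vac U G \<longleftrightarrow>
     U = module.span sc {nmono vac ps | ps. set (map fst ps) \<subseteq> G}"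

end

theory Submission
  imports Defs "HOL-Library.Function_Algebras"
begin

text \<open>With x = L1 - L2 and l = L1 + L2 the fixed points of the swap are spanned by the words in the
  modes of l and x with an even number of letters x. Working by induction on the conformal weight N,
  a word of weight N starting with l (after commuting an l to the front), or starting with two letters x and followed by something of
  positive weight, is reduced by lower-weight states: the fields of such states are, by Goddard's
  uniqueness theorem (which rests on Dong's lemma), combinations of nested normally ordered
  products of generators. There remain the quadratic states x(-a) x(-b) vac with a + b = N. Modulo
  the translation operator they are multiples of a single q, which vanishes for N odd and is a multiple
  of w_N for N even. For even N \<ge> 10 the quartic words x(-t-2) x(-b-2) x(-2) x(-2) vac can
  be regrouped in two ways, which gives a relation rho q = 0 with rho linear in c. For N = 10
  it is proportional to (256 - 47 c) q = 0; for even N \<ge> 12 the cases b = 1 and b = 2 have no common root c.\<close>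

section \<open>Difference operators and truncated functions\<close>

text \<open>The model gives modes of L1 and L2 only and no state-field correspondence, so the
  calculus of fields is built from coefficient functions. A series in z and w is a function of two
  indices, entry (p, q) being the coefficient of z^(-p-1) w^(-q-1); then \<open>dz\<close> is
  multiplication by z - w. It is injective on functions that vanish for large q, and Dong's lemma,
  covariance and uniqueness are all obtained by cancelling powers of z - w. The obstacle in the
  weight induction is that correction terms keep the weight N. They are shorter words, whence a
  second induction on length; it stops at the quadratic states, whose normally ordered product has
  weight N itself and so is not known beforehand. c enters \<open>rho\<close> only through the
  central term of [x(n), x(-n)]. For b = 0 the two regroupings coincide, so N = 10 is the first even
  weight with a relation. Of its two candidates, b = 1 has the root 256/47 and b = 2 is identically
  zero, so at this c a generator of weight 10 is supplied instead.\<close>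

definition dz :: "(int \<Rightarrow> int \<Rightarrow> 'w::ab_group_add) \<Rightarrow> int \<Rightarrow> int \<Rightarrow> 'w" where
  "dz f p q = f (p + 1) q - f p (q + 1)"

text \<open>Multiplication by z - w, z - u and w - u on series in three variables z, w, u with
  indices p, q, r.\<close>

definition zw :: "(int \<Rightarrow> int \<Rightarrow> int \<Rightarrow> 'w::ab_group_add) \<Rightarrow> int \<Rightarrow> int \<Rightarrow> int \<Rightarrow> 'w" where
  "zw f p q r = f (p + 1) q r - f p (q + 1) r"

definition zu :: "(int \<Rightarrow> int \<Rightarrow> int \<Rightarrow> 'w::ab_group_add) \<Rightarrow> int \<Rightarrow> int \<Rightarrow> int \<Rightarrow> 'w" where
  "zu f p q r = f (p + 1) q r - f p q (r + 1)"

definition wu :: "(int \<Rightarrow> int \<Rightarrow> int \<Rightarrow> 'w::ab_group_add) \<Rightarrow> int \<Rightarrow> int \<Rightarrow> int \<Rightarrow> 'w" where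
  "wu f p q r = f p (q + 1) r - f p q (r + 1)"

lemma zw_diff: "zw (f - g) = zw f - zw g"
  and zu_diff: "zu (f - g) = zu f - zu g"
  and wu_diff: "wu (f - g) = wu f - wu g"
  and dz_diff: "dz (h - k) = dz h - dz k"
  by (auto simp: zw_def zu_def wu_def dz_def fun_eq_iff)

lemma zw_zu: "zw (zu f) = zu (zw f)"
  and zw_wu: "zw (wu f) = wu (zw f)"
  and zu_wu: "zu (wu f) = wu (zu f)"
  by (auto simp: zw_def zu_def wu_def fun_eq_iff algebra_simps)

lemma wu_eq: "wu f = zu f - zw f"
  by (auto simp: zw_def zu_def wu_def fun_eq_iff)

lemma pow_diff:
  fixes D :: "'a::ab_group_add \<Rightarrow> 'a"
  assumes "\<And>f g. D (f - g) = D f - D g"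
  shows "(D ^^ n) (f - g) = (D ^^ n) f - (D ^^ n) g"
  by (induction n) (auto simp: assms)

lemma pow_zero:
  fixes D :: "'a::ab_group_add \<Rightarrow> 'a"
  assumes "\<And>f g. D (f - g) = D f - D g"
  shows "(D ^^ n) 0 = 0"
  using pow_diff[OF assms, of n 0 0] by simp

lemma pow_commute1:
  assumes "\<And>f. D (E f) = E (D f)"
  shows "(D ^^ n) (E f) = E ((D ^^ n) f)"
  by (induction n) (auto simp: assms)

lemma pow_commute:
  assumes "\<And>f. D (E f) = E (D f)"
  shows "(D ^^ n) ((E ^^ m) f) = (E ^^ m) ((D ^^ n) f)"
  by (induction m) (auto simp: pow_commute1[where D=D and E=E, OF assms])

text \<open>In each term of the binomial expansion of (D2 - D1)^(a+b), D1 has exponent at least a or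
  D2 at least b. The induction avoids the expansion: it splits off one factor \<open>D3\<close>,
  after which a or b has dropped by one.\<close>

lemma pow_difference_zero:
  fixes D1 D2 :: "'a::ab_group_add \<Rightarrow> 'a"
  assumes D1: "\<And>f g. D1 (f - g) = D1 f - D1 g" and D2: "\<And>f g. D2 (f - g) = D2 f - D2 g"
    and D3: "\<And>f. D3 f = D2 f - D1 f" and comm: "\<And>f. D1 (D2 f) = D2 (D1 f)"
  shows "(D1 ^^ a) h = 0 \<Longrightarrow> (D2 ^^ b) h = 0 \<Longrightarrow> (D3 ^^ (a + b)) h = 0"
proof (induction "a + b" arbitrary: a b h)
  case 0
  then show ?case by simp
next
  case (Suc n)
  have D3d: "D3 (f - g) = D3 f - D3 g" for f g by (simp add: D1 D2 D3)
  show ?case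
  proof (cases "a = 0 \<or> b = 0")
    case True
    then have "h = 0" using Suc.prems by auto
    then show ?thesis using pow_zero[of D3, OF D3d] by simp
  next
    case False
    then obtain a' b' where ab: "a = Suc a'" "b = Suc b'" by (meson not0_implies_Suc)
    have "(D1 ^^ a) (D2 h) = 0"
      using pow_commute1[where D=D1 and E=D2, OF comm, of a h] Suc.prems pow_zero[of D2, OF D2, of 1]
      by simp
    moreover have "(D2 ^^ b') (D2 h) = 0"
      using Suc.prems ab by (simp add: funpow_swap1)
    ultimately have 1: "(D3 ^^ n) (D2 h) = 0"
      using Suc.hyps(1)[of a b' "D2 h"] Suc.hyps(2) ab by simp
    have "(D2 ^^ b) (D1 h) = 0"
      using pow_commute1[where D=D2 and E=D1, of b h] comm Suc.prems pow_zero[of D1, OF D1, of 1]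
      by simp
    moreover have "(D1 ^^ a') (D1 h) = 0"
      using Suc.prems ab by (simp add: funpow_swap1)
    ultimately have 2: "(D3 ^^ n) (D1 h) = 0"
      using Suc.hyps(1)[of a' b "D1 h"] Suc.hyps(2) ab by simp
    have "(D3 ^^ (a + b)) h = (D3 ^^ n) (D3 h)"
      using Suc.hyps(2) by (metis funpow_Suc_right o_apply)
    then show ?thesis using 1 2 pow_diff[of D3, OF D3d, of n "D2 h" "D1 h"] by (simp add: D3)
  qed
qed

lemma zw_pow: "(zw ^^ n) f p q r = (dz ^^ n) (\<lambda>p q. f p q r) p q"
  and zu_pow: "(zu ^^ n) f p q r = (dz ^^ n) (\<lambda>p r. f p q r) p r"
  and wu_pow: "(wu ^^ n) f p q r = (dz ^^ n) (\<lambda>q r. f p q r) q r"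
  by (induction n arbitrary: p q r) (auto simp: zw_def zu_def wu_def dz_def)

lemma dz_pow_hom:
  assumes "\<And>x y. g (x - y) = g x - g y"
  shows "(dz ^^ n) (\<lambda>p q. g (f p q)) p q = g ((dz ^^ n) f p q)"
  by (induction n arbitrary: p q) (auto simp: dz_def assms)

lemma dz_pow_flip:
  "(dz ^^ n) (\<lambda>p q. f q p) p q = (if even n then (dz ^^ n) f q p else - (dz ^^ n) f q p)"
  by (induction n arbitrary: p q) (auto simp: dz_def)

text \<open>The bound is uniform in p. This is the shape of the coefficients of A(z) B(w) v for a
  field B, also after division by powers of z - w expanded for large z.\<close>

definition qtrunc :: "(int \<Rightarrow> int \<Rightarrow> 'w::ab_group_add) \<Rightarrow> bool" where
  "qtrunc f \<longleftrightarrow> (\<exists>Q. \<forall>p. \<forall>q\<ge>Q. f p q = 0)"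

text \<open>If z - w kills f, then f is constant along the lines p + q = const, and each such line
  runs into the region where f vanishes.\<close>

lemma dz_inj:
  assumes "qtrunc f" "dz f = 0" shows "f = 0"
proof -
  from assms(1) obtain Q where Q: "\<And>p q. q \<ge> Q \<Longrightarrow> f p q = 0" by (auto simp: qtrunc_def)
  have step: "f (p + 1) q = f p (q + 1)" for p q
    using fun_cong[OF fun_cong[OF assms(2)], of p q] by (simp add: dz_def)
  have "f p q = f (p - int k) (q + int k)" for p q k
    by (induction k) (use step[of "p - 1 - int k" "q + int k" for k] in \<open>auto simp: algebra_simps\<close>)
  from this[where k = "nat (Q - q)" for q] Q have "f p q = 0" for p q
    by (metis add_diff_cancel_left' add_increasing2 diff_add_cancel int_nat_eq le_cases nat_0_iff
        of_nat_0_le_iff order_refl add.commute diff_ge_0_iff_ge)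
  then show ?thesis by (simp add: fun_eq_iff)
qed

lemma qtrunc_dz: "qtrunc f \<Longrightarrow> qtrunc (dz f)"
  unfolding qtrunc_def dz_def by (metis add.commute diff_zero zle_add1_eq_le order_less_le order_trans zless_add1_eq)

lemma dz_pow_inj: "qtrunc f \<Longrightarrow> (dz ^^ n) f = 0 \<Longrightarrow> f = 0"
  by (induction n arbitrary: f) (auto simp: funpow_swap1 qtrunc_dz dz_inj simp del: funpow.simps(2) simp: funpow_Suc_right)

text \<open>Exchanging z and w exchanges w - u and z - u. The second half of a normally ordered
  product has A and B in reversed roles, and this carries results for the first half over to
  it.\<close>

lemma wu_pow_flip:
  assumes "\<And>x y. g (x - y) = g x - g y"
  shows "(wu ^^ n) (\<lambda>p q r. g (f q p r)) = (\<lambda>p q r. g ((zu ^^ n) f q p r))"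
    and "(zu ^^ n) (\<lambda>p q r. g (f q p r)) = (\<lambda>p q r. g ((wu ^^ n) f q p r))"
  by (induction n) (auto simp: wu_def zu_def fun_eq_iff assms)

text \<open>The bound in q may depend on r, and one application of \<open>zu\<close> or
  \<open>wu\<close> consults both r and r + 1; hence the hypothesis for all r at once.\<close>

lemma qtrunc_zu_wu:
  assumes "\<forall>r. qtrunc (\<lambda>p q. f p q r)"
  shows "\<forall>r. qtrunc (\<lambda>p q. (zu ^^ a) ((wu ^^ b) f) p q r)"
proof -
  have zu: "\<forall>r. qtrunc (\<lambda>p q. zu f p q r)" if tr: "\<forall>r. qtrunc (\<lambda>p q. f p q r)"
    for f :: "int \<Rightarrow> int \<Rightarrow> int \<Rightarrow> 'a"
  proof
    fix r
    obtain Q R where "\<And>p q. q \<ge> Q \<Longrightarrow> f p q r = 0" "\<And>p q. q \<ge> R \<Longrightarrow> f p q (r + 1) = 0"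
      using spec[OF tr, of r] spec[OF tr, of "r + 1"] unfolding qtrunc_def by blast
    then show "qtrunc (\<lambda>p q. zu f p q r)"
      unfolding qtrunc_def zu_def by (intro exI[of _ "max Q R"]) auto
  qed
  have wu: "\<forall>r. qtrunc (\<lambda>p q. wu f p q r)" if tr: "\<forall>r. qtrunc (\<lambda>p q. f p q r)"
    for f :: "int \<Rightarrow> int \<Rightarrow> int \<Rightarrow> 'a"
  proof
    fix r
    obtain Q R where "\<And>p q. q \<ge> Q \<Longrightarrow> f p q r = 0" "\<And>p q. q \<ge> R \<Longrightarrow> f p q (r + 1) = 0"
      using spec[OF tr, of r] spec[OF tr, of "r + 1"] unfolding qtrunc_def by blast
    then show "qtrunc (\<lambda>p q. wu f p q r)"
      unfolding qtrunc_def wu_def by (intro exI[of _ "max Q R"]) auto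
  qed
  have "\<forall>r. qtrunc (\<lambda>p q. (wu ^^ b) f p q r)" by (induction b) (use assms wu in auto)
  then show ?thesis by (induction a) (use zu in auto)
qed

section \<open>Fields and normally ordered products\<close>

locale vertex_fields = vector_space sc for sc :: "complex \<Rightarrow> 'w::ab_group_add \<Rightarrow> 'w"
begin

definition fld :: "(int \<Rightarrow> 'w \<Rightarrow> 'w) \<Rightarrow> bool" where
  "fld A \<longleftrightarrow> (\<forall>n. module_hom sc sc (A n)) \<and> (\<forall>v. \<exists>N. \<forall>n\<ge>N. A n v = 0)"

lemma hom_intro: "(\<And>x y. f (x + y) = f x + f y) \<Longrightarrow> (\<And>a x. f (sc a x) = sc a (f x)) \<Longrightarrow> module_hom sc sc f"
  by (simp add: module_hom_iff module_axioms)

lemma fld_add: "fld A \<Longrightarrow> A n (x + y) = A n x + A n y"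
  and fld_diff: "fld A \<Longrightarrow> A n (x - y) = A n x - A n y"
  and fld_minus: "fld A \<Longrightarrow> A n (- x) = - A n x"
  and fld_0: "fld A \<Longrightarrow> A n 0 = 0"
  and fld_sc: "fld A \<Longrightarrow> A n (sc a x) = sc a (A n x)"
  and fld_sum: "fld A \<Longrightarrow> A n (sum g I) = (\<Sum>i\<in>I. A n (g i))"
  by (auto simp: fld_def intro: module_hom.add module_hom.diff module_hom.neg module_hom.zero
      module_hom.scale module_hom.sum)

lemmas fld_simps = fld_add fld_diff fld_minus fld_0 fld_sc fld_sum

lemma fld_bound: "fld A \<Longrightarrow> \<exists>N. \<forall>n\<ge>N. A n v = 0"
  by (auto simp: fld_def)

lemma fld_bound_nat: 
  assumes "fld A" shows "\<exists>M. \<forall>i\<ge>M. A (q + int i) v = 0"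
proof -
  obtain N where "\<And>n. n \<ge> N \<Longrightarrow> A n v = 0" using fld_bound[OF assms] by blast
  then show ?thesis by (intro exI[of _ "nat (N - q)"]) auto
qed

text \<open>One exponent K serves all vectors: Dong's lemma uses the relation at v and also at B q v
  and C r v.\<close>

definition local_to :: "(int \<Rightarrow> 'w \<Rightarrow> 'w) \<Rightarrow> (int \<Rightarrow> 'w \<Rightarrow> 'w) \<Rightarrow> bool" where
  "local_to A B \<longleftrightarrow> (\<exists>K. \<forall>v. (dz ^^ K) (\<lambda>p q. A p (B q v) - B q (A p v)) = 0)"

lemma local_to_sym: "local_to A B \<Longrightarrow> local_to B A"
proof -
  assume "local_to A B"
  then obtain K where K: "\<And>v. (dz ^^ K) (\<lambda>p q. A p (B q v) - B q (A p v)) = 0"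
    by (auto simp: local_to_def)
  have "(dz ^^ K) (\<lambda>p q. B p (A q v) - A q (B p v)) p q = 0" for v p q
  proof -
    have "(dz ^^ K) (\<lambda>p q. - (\<lambda>p q. A p (B q v) - B q (A p v)) q p) p q
       = - (dz ^^ K) (\<lambda>p q. (\<lambda>p q. A p (B q v) - B q (A p v)) q p) p q"
      by (rule dz_pow_hom) auto
    then show ?thesis using dz_pow_flip[of K "\<lambda>p q. A p (B q v) - B q (A p v)" p q] K[of v]
      by simp
  qed
  then show ?thesis by (auto simp: local_to_def fun_eq_iff)
qed

text \<open>The coefficients of (z - w)^(-j-1) A(z) B(w) v, expanded for large z.\<close>

definition H1 :: "(int \<Rightarrow> 'w \<Rightarrow> 'w) \<Rightarrow> (int \<Rightarrow> 'w \<Rightarrow> 'w) \<Rightarrow> nat \<Rightarrow> 'w \<Rightarrow> int \<Rightarrow> int \<Rightarrow> 'w" where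
  "H1 A B j v p q = (\<Sum>i | B (q + int i) v \<noteq> 0.
     sc (of_nat ((j + i) choose i)) (A (p - int j - 1 - int i) (B (q + int i) v)))"

text \<open>The expansion of (z - w)^(-j-1) A(z) B(w) for large z minus that of (z - w)^(-j-1) B(w)
  A(z) for large w; the sign comes from (z - w)^(-j-1) = (-1)^(j+1) (w - z)^(-j-1).\<close>

definition HH :: "(int \<Rightarrow> 'w \<Rightarrow> 'w) \<Rightarrow> (int \<Rightarrow> 'w \<Rightarrow> 'w) \<Rightarrow> nat \<Rightarrow> 'w \<Rightarrow> int \<Rightarrow> int \<Rightarrow> 'w" where
  "HH A B j v p q = H1 A B j v p q + sc ((-1) ^ j) (H1 B A j v q p)"

lemma H1_eq:
  assumes "fld A" "\<And>i. i \<ge> M \<Longrightarrow> B (q + int i) v = 0"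
  shows "H1 A B j v p q = (\<Sum>i<M. sc (of_nat ((j + i) choose i)) (A (p - int j - 1 - int i) (B (q + int i) v)))"
proof -
  have "{i. B (q + int i) v \<noteq> 0} \<subseteq> {..<M}"
    using assms(2) linorder_not_less by blast
  then show ?thesis unfolding H1_def
    by (intro sum.mono_neutral_left) (auto simp: fld_0[OF assms(1)])
qed

lemma nop_eq_sum:
  assumes "fld A" "fld B" "\<And>i. i \<ge> M \<Longrightarrow> B (n + int i) v = 0" "\<And>i. i \<ge> M \<Longrightarrow> A (int i) v = 0"
  shows "nop sc A B j n v = (\<Sum>i<M. nop_term sc A B j n v i)"
proof -
  have "nop_term sc A B j n v i = 0" if "i \<ge> M" for i
    using assms(3,4)[OF that] by (simp add: nop_term_def fld_0[OF assms(1)] fld_0[OF assms(2)])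
  then have "{i. nop_term sc A B j n v i \<noteq> 0} \<subseteq> {..<M}"
    using linorder_not_less by blast
  then show ?thesis unfolding nop_def by (intro sum.mono_neutral_left) auto
qed

lemma nop_bound:
  assumes "fld A" "fld B"
  shows "\<exists>M. \<forall>i\<ge>M. B (n + int i) v = 0 \<and> A (int i) v = 0"
proof -
  obtain M N where "\<forall>i\<ge>M. B (n + int i) v = 0" "\<forall>i\<ge>N. A (0 + int i) v = 0"
    using fld_bound_nat[OF assms(1)] fld_bound_nat[OF assms(2)] by metis
  then show ?thesis by (intro exI[of _ "max M N"]) auto
qed

text \<open>The index p = 0 belongs to z^(-1), so the normally ordered product is the residue of
  \<open>HH\<close> in z.\<close>

lemma nop_eq:
  assumes "fld A" "fld B"
  shows "nop sc A B j n v = HH A B j v 0 n"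
proof -
  obtain M where M: "\<And>i. i \<ge> M \<Longrightarrow> B (n + int i) v = 0" "\<And>i. i \<ge> M \<Longrightarrow> A (0 + int i) v = 0"
    using nop_bound[OF assms, of n v] by auto
  show ?thesis
    using M by (simp add: nop_eq_sum[OF assms, of M] HH_def H1_eq[OF assms(1), of M B n v]
        H1_eq[OF assms(2), of M A 0 v, simplified] nop_term_def scale_right_distrib sum.distrib scale_sum_right mult.commute)
qed

text \<open>Multiplying by z - w lowers the order of the pole by one; on coefficients this is
  Pascal's rule. The sum for q + 1 is one term shorter than that for q, so the two match after an
  index shift.\<close>

lemma dz_H1:
  assumes "fld A" "fld B"
  shows "dz (H1 A B 0 v) p q = A p (B q v)"
    and "dz (H1 A B (Suc j) v) p q = H1 A B j v p q"
proof -
  obtain M where M: "\<And>i. i \<ge> M \<Longrightarrow> B (q + int i) v = 0"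
    using fld_bound_nat[OF assms(2)] by meson
  have M': "B (q + 1 + int i) v = 0" if "i \<ge> M" for i
    using M[of "Suc i"] that by (simp add: add_ac)
  have MS: "B (q + int i) v = 0" if "i \<ge> Suc M" for i
    using M that by auto
  have HS: "H1 A B k v p' q = (\<Sum>i<Suc M. sc (of_nat ((k + i) choose i)) (A (p' - int k - 1 - int i) (B (q + int i) v)))" for k p'
    by (rule H1_eq[where A=A and B=B and M="Suc M", OF assms(1)]) (use MS in auto)
  have HM: "H1 A B k v p' (q + 1) = (\<Sum>i<M. sc (of_nat ((k + i) choose i)) (A (p' - int k - 1 - int i) (B (q + 1 + int i) v)))" for k p'
    by (rule H1_eq[where A=A and B=B and M=M, OF assms(1)]) (use M' in auto)
  have diff: "dz (H1 A B k v) p q = A (p - int k) (B q v)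
     + (\<Sum>i<M. sc (of_nat ((k + Suc i) choose Suc i) - of_nat ((k + i) choose i)) (A (p - int k - 1 - int i) (B (q + 1 + int i) v)))" for k
    unfolding dz_def HS HM
    by (simp add: sum.lessThan_Suc_shift scale_left_diff_distrib sum_subtractf add_ac algebra_simps del: sum.lessThan_Suc binomial_Suc_Suc)
  show "dz (H1 A B 0 v) p q = A p (B q v)"
    by (simp add: diff del: binomial_Suc_Suc)
  have pascal: "of_nat (Suc j + Suc i choose Suc i) - of_nat (Suc j + i choose i) = (of_nat (j + Suc i choose Suc i) :: complex)" for i
    by simp
  show "dz (H1 A B (Suc j) v) p q = H1 A B j v p q"
    unfolding diff pascal HS
    by (simp add: sum.lessThan_Suc_shift add_ac algebra_simps del: sum.lessThan_Suc binomial_Suc_Suc)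
qed

lemma dz_pow_H1:
  assumes "fld A" "fld B"
  shows "(dz ^^ Suc j) (H1 A B j v) = (\<lambda>p q. A p (B q v))"
proof (induction j)
  case 0
  then show ?case using dz_H1(1)[OF assms] by (simp add: fun_eq_iff)
next
  case (Suc j)
  have "dz (H1 A B (Suc j) v) = H1 A B j v" using dz_H1(2)[OF assms] by (simp add: fun_eq_iff)
  then show ?case using Suc by (metis funpow_Suc_right o_apply)
qed

text \<open>Once the pole is cleared, both expansions are plain products and their difference is the
  commutator. For local A and B a further power of z - w therefore kills \<open>HH\<close>.\<close>

lemma dz_pow_HH:
  assumes "fld A" "fld B"
  shows "(dz ^^ Suc j) (HH A B j v) = (\<lambda>p q. A p (B q v) - B q (A p v))"
proof -
  have eq: "HH A B j v = H1 A B j v - (\<lambda>p q. - sc ((-1) ^ j) (H1 B A j v q p))"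
    by (auto simp: HH_def fun_eq_iff)
  have "(dz ^^ Suc j) (\<lambda>p q. - sc ((-1) ^ j) (H1 B A j v q p)) p q
      = - sc ((-1) ^ j) ((dz ^^ Suc j) (\<lambda>p q. H1 B A j v q p) p q)" for p q
    by (rule dz_pow_hom[where g="\<lambda>x. - sc ((-1) ^ j) x"]) (simp add: scale_right_diff_distrib)
  also have "\<dots> p q = B q (A p v)" for p q
    unfolding dz_pow_flip dz_pow_H1[OF assms(2,1)] by auto
  finally show ?thesis
    unfolding eq pow_diff[of dz, OF dz_diff] dz_pow_H1[OF assms] by (auto simp: fun_eq_iff)
qed

lemma qtrunc_H1: assumes "fld A" "fld B" shows "qtrunc (H1 A B j v)"
proof -
  obtain N where "\<And>n. n \<ge> N \<Longrightarrow> B n v = 0" using fld_bound[OF assms(2)] by blast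
  then show ?thesis unfolding qtrunc_def by (intro exI[of _ N]) (auto simp: H1_def)
qed

lemma fld_nop:
  assumes "fld A" "fld B"
  shows "fld (nop sc A B j)"
  unfolding fld_def
proof (intro conjI allI)
  fix n
  show "module_hom sc sc (nop sc A B j n)"
  proof (rule hom_intro)
    fix x y
    obtain M1 M2 where M1: "\<forall>i\<ge>M1. B (n + int i) x = 0 \<and> A (int i) x = 0"
      and M2: "\<forall>i\<ge>M2. B (n + int i) y = 0 \<and> A (int i) y = 0"
      using nop_bound[OF assms] by metis
    show "nop sc A B j n (x + y) = nop sc A B j n x + nop sc A B j n y"
      using M1 M2 by (simp add: nop_eq_sum[OF assms, of "max M1 M2"] nop_term_def fld_simps assms
          sum.distrib algebra_simps scale_right_distrib)
  next
    fix a x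
    obtain M1 where M1: "\<forall>i\<ge>M1. B (n + int i) x = 0 \<and> A (int i) x = 0"
      using nop_bound[OF assms] by metis
    then show "nop sc A B j n (sc a x) = sc a (nop sc A B j n x)"
      by (simp add: nop_eq_sum[OF assms, of M1] nop_term_def fld_simps assms
          scale_sum_right algebra_simps scale_right_distrib)
  qed
next
  fix v
  obtain N where N: "\<And>n. n \<ge> N \<Longrightarrow> B n v = 0" using fld_bound[OF assms(2)] by blast
  obtain M where M: "\<And>i. i \<ge> M \<Longrightarrow> A (int i) v = 0" using fld_bound_nat[OF assms(1), of 0] by auto
  \<comment> \<open>The truncation bound of B depends on the vector A i v; only finitely many of
    these are nonzero, so a common bound P exists.\<close>
  have "\<exists>P. \<forall>i<M. \<forall>n\<ge>P. B n (A (int i) v) = 0"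
  proof (induction M)
    case (Suc M)
    then obtain P where P: "\<forall>i<M. \<forall>n\<ge>P. B n (A (int i) v) = 0" by blast
    obtain R where R: "\<forall>n\<ge>R. B n (A (int M) v) = 0" using fld_bound[OF assms(2)] by blast
    show ?case by (intro exI[of _ "max P R"]) (use P R in \<open>auto simp: less_Suc_eq\<close>)
  qed auto
  then obtain P where P: "\<And>i n. i < M \<Longrightarrow> n \<ge> P \<Longrightarrow> B n (A (int i) v) = 0" by blast
  show "\<exists>N. \<forall>n\<ge>N. nop sc A B j n v = 0"
  proof (intro exI[of _ "max N (P + int j + 1 + int M)"] allI impI)
    fix n assume n: "n \<ge> max N (P + int j + 1 + int M)"
    have "nop_term sc A B j n v i = 0" for i
      using n N[of "n + int i"] M[of i] P[of i "n - int j - 1 - int i"]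
      by (cases "i < M") (auto simp: nop_term_def fld_0 assms)
    then show "nop sc A B j n v = 0" by (simp add: nop_def)
  qed
qed

subsection \<open>Dong's lemma\<close>

text \<open>As (z - w)^(j+1) is injective on truncated functions, it may be multiplied in first. The
  pole then disappears and A B C - C A B = \<open>F1 - F2\<close>, where \<open>F1\<close> contains
  the commutator of B and C and \<open>F2\<close> that of A and C.\<close>

lemma local_half:
  assumes "fld A" "fld B" "fld C"
    and K1: "\<And>v. (dz ^^ K1) (\<lambda>p r. A p (C r v) - C r (A p v)) = 0"
    and K2: "\<And>v. (dz ^^ K2) (\<lambda>q r. B q (C r v) - C r (B q v)) = 0"
  shows "(zu ^^ K1) ((wu ^^ K2) (\<lambda>p q r. H1 A B j (C r v) p q - C r (H1 A B j v p q))) = 0"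
proof -
  define t where "t = (\<lambda>p q r. H1 A B j (C r v) p q - C r (H1 A B j v p q))"
  define s where "s = (zu ^^ K1) ((wu ^^ K2) t)"
  define F1 where "F1 = (\<lambda>p q r. A p (B q (C r v)) - A p (C r (B q v)))"
  define F2 where "F2 = (\<lambda>p q r. C r (A p (B q v)) - A p (C r (B q v)))"
  have zwt: "(zw ^^ Suc j) t = F1 - F2"
  proof -
    have "(zw ^^ Suc j) t p q r = A p (B q (C r v)) - C r (A p (B q v))" for p q r
    proof -
      have "(\<lambda>p q. t p q r) = H1 A B j (C r v) - (\<lambda>p q. C r (H1 A B j v p q))"
        by (auto simp: t_def fun_eq_iff)
      then show ?thesis
        unfolding zw_pow
        by (simp only: pow_diff[of dz, OF dz_diff] dz_pow_H1[OF assms(1,2)] minus_apply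
            dz_pow_hom[of "C r", OF fld_diff[OF assms(3)]])
    qed
    then show ?thesis by (auto simp: F1_def F2_def fun_eq_iff)
  qed
  have "(wu ^^ K2) F1 p q r = 0" for p q r
    unfolding wu_pow F1_def
    using dz_pow_hom[of "A p" K2 "\<lambda>q r. B q (C r v) - C r (B q v)" q r, OF fld_diff[OF assms(1)]]
      K2[of v] by (simp add: fld_diff fld_0 assms)
  then have "(wu ^^ K2) F1 = 0" by (simp add: fun_eq_iff)
  then have F1: "(zu ^^ K1) ((wu ^^ K2) F1) = 0" by (simp add: pow_zero[of zu, OF zu_diff])
  have "(zu ^^ K1) F2 p q r = 0" for p q r
    unfolding zu_pow F2_def
    using dz_pow_hom[of uminus K1 "\<lambda>p r. A p (C r (B q v)) - C r (A p (B q v))" p r]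
      K1[of "B q v"] by simp
  then have "(zu ^^ K1) F2 = 0" by (simp add: fun_eq_iff)
  then have F2: "(zu ^^ K1) ((wu ^^ K2) F2) = 0"
    by (simp add: pow_zero[of wu, OF wu_diff] pow_commute[of zu wu, OF zu_wu])
  have "(zw ^^ Suc j) s = (zu ^^ K1) ((wu ^^ K2) (F1 - F2))"
    unfolding s_def zwt[symmetric]
    by (simp only: pow_commute[of zw zu, OF zw_zu] pow_commute[of zw wu, OF zw_wu])
  also have "\<dots> = 0"
    by (simp add: pow_diff[of wu, OF wu_diff] pow_diff[of zu, OF zu_diff] F1 F2)
  finally have zws: "(zw ^^ Suc j) s = 0" .
  have "qtrunc (\<lambda>p q. t p q r)" for r
  proof -
    obtain Q1 Q2 where "\<And>p q. q \<ge> Q1 \<Longrightarrow> H1 A B j v p q = 0" "\<And>p q. q \<ge> Q2 \<Longrightarrow> H1 A B j (C r v) p q = 0"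
      using qtrunc_H1[OF assms(1,2), of j v] qtrunc_H1[OF assms(1,2), of j "C r v"]
      unfolding qtrunc_def by blast
    then show ?thesis unfolding qtrunc_def t_def
      by (intro exI[of _ "max Q1 Q2"]) (auto simp: fld_0 assms)
  qed
  then have "\<forall>r. qtrunc (\<lambda>p q. s p q r)" unfolding s_def by (intro qtrunc_zu_wu) auto
  moreover have "(dz ^^ Suc j) (\<lambda>p q. s p q r) = 0" for r
    by (intro ext) (simp only: zw_pow[symmetric] zws zero_fun_apply)
  ultimately have "(\<lambda>p q. s p q r) = 0" for r
    using dz_pow_inj by blast
  then have "s p q r = 0" for p q r by (simp only: fun_eq_iff zero_fun_apply)
  then show ?thesis by (simp add: fun_eq_iff s_def t_def)
qed

text \<open>The commutator h of \<open>HH\<close> with C is killed by (z - w)^a, since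
  \<open>HH\<close> is, and by (z - u)^K1 (w - u)^K2, by \<open>local_half\<close> for both halves.
  Hence (w - u)^K2 h is killed by powers of z - w and of z - u, thus by a power of their difference
  w - u. Taking p = 0 gives the claim.\<close>

lemma local_nop:
  assumes "fld A" "fld B" "fld C"
    and "local_to A B" "local_to A C" "local_to B C"
  shows "local_to (nop sc A B j) C"
proof -
  obtain K where K: "\<And>v. (dz ^^ K) (\<lambda>p r. A p (B r v) - B r (A p v)) = 0"
    using assms(4) by (auto simp: local_to_def)
  obtain K1 where K1: "\<And>v. (dz ^^ K1) (\<lambda>p r. A p (C r v) - C r (A p v)) = 0"
    using assms(5) by (auto simp: local_to_def)
  obtain K2 where K2: "\<And>v. (dz ^^ K2) (\<lambda>q r. B q (C r v) - C r (B q v)) = 0"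
    using assms(6) by (auto simp: local_to_def)
  define a where "a = K + Suc j"
  have dzHH: "(dz ^^ a) (HH A B j v) = 0" for v
    unfolding a_def funpow_add o_apply dz_pow_HH[OF assms(1,2)] K ..
  have "(dz ^^ (a + K1 + K2)) (\<lambda>q r. nop sc A B j q (C r v) - C r (nop sc A B j q v)) = 0" for v
  proof -
    define h where "h = (\<lambda>p q r. HH A B j (C r v) p q - C r (HH A B j v p q))"
    define t1 where "t1 = (\<lambda>p q r. H1 A B j (C r v) p q - C r (H1 A B j v p q))"
    define t2 where "t2 = (\<lambda>p q r. H1 B A j (C r v) p q - C r (H1 B A j v p q))"
    define g where "g = (\<lambda>x. - sc ((-1) ^ j) x)"
    have gd: "g (x - y) = g x - g y" for x y by (simp add: g_def scale_right_diff_distrib)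
    have ht: "h = t1 - (\<lambda>p q r. g (t2 q p r))"
      by (auto simp: h_def t1_def t2_def g_def fun_eq_iff HH_def fld_simps assms scale_right_diff_distrib)
    have "(zw ^^ a) h p q r = 0" for p q r
    proof -
      have "(\<lambda>p q. h p q r) = HH A B j (C r v) - (\<lambda>p q. C r (HH A B j v p q))"
        by (auto simp: h_def fun_eq_iff)
      then show ?thesis
        unfolding zw_pow
        by (simp add: pow_diff[of dz, OF dz_diff] dzHH fld_0 assms(3) 
            dz_pow_hom[of "C r", OF fld_diff[OF assms(3)]])
    qed
    then have zwh: "(zw ^^ a) h = 0" by (simp add: fun_eq_iff)
    have t1: "(zu ^^ K1) ((wu ^^ K2) t1) = 0"
      unfolding t1_def by (rule local_half[OF assms(1-3) K1 K2])
    have t2: "(zu ^^ K2) ((wu ^^ K1) t2) = 0"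
      unfolding t2_def by (rule local_half[OF assms(2,1,3) K2 K1])
    have g0: "g 0 = 0" by (simp add: g_def)
    have "(zu ^^ K1) ((wu ^^ K2) (\<lambda>p q r. g (t2 q p r))) = 0"
      unfolding wu_pow_flip[of g, OF gd] pow_commute[of zu wu, OF zu_wu, symmetric] t2
      by (simp add: g0 fun_eq_iff)
    then have zuwu: "(zu ^^ K1) ((wu ^^ K2) h) = 0"
      unfolding ht by (simp add: pow_diff[of wu, OF wu_diff] pow_diff[of zu, OF zu_diff] t1)
    have "(zw ^^ a) ((wu ^^ K2) h) = 0"
      by (simp add: pow_commute[of zw wu, OF zw_wu] zwh pow_zero[of wu, OF wu_diff])
    from pow_difference_zero[OF zw_diff zu_diff wu_eq zw_zu this zuwu]
    have "(wu ^^ (a + K1 + K2)) h = 0" by (simp add: funpow_add)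
    then have "(dz ^^ (a + K1 + K2)) (\<lambda>q r. h 0 q r) q r = 0" for q r
      by (simp only: wu_pow[symmetric] zero_fun_apply)
    moreover have "h 0 q r = nop sc A B j q (C r v) - C r (nop sc A B j q v)" for q r
      by (simp add: h_def nop_eq[OF assms(1,2)])
    ultimately show ?thesis by (simp add: fun_eq_iff)
  qed
  then show ?thesis unfolding local_to_def by blast
qed

lemma dz_pow_zero_mono:
  assumes "(dz ^^ K) f = 0" "K \<le> M" shows "(dz ^^ M) f = 0"
proof -
  have "(dz ^^ M) f = (dz ^^ (M - K)) ((dz ^^ K) f)"
    using assms(2) by (metis funpow_add le_add_diff_inverse2 o_apply)
  then show ?thesis using assms(1) by (simp add: pow_zero[of dz, OF dz_diff])
qed

lemma local_add:
  assumes "fld C" "local_to A C" "local_to B C"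
  shows "local_to (\<lambda>n v. A n v + B n v) C"
proof -
  obtain K1 K2 where K1: "\<And>v. (dz ^^ K1) (\<lambda>p r. A p (C r v) - C r (A p v)) = 0"
    and K2: "\<And>v. (dz ^^ K2) (\<lambda>q r. B q (C r v) - C r (B q v)) = 0"
    using assms by (auto simp: local_to_def)
  have "(dz ^^ (max K1 K2)) (\<lambda>p r. (A p (C r v) + B p (C r v)) - C r (A p v + B p v)) = 0" for v
  proof -
    have eq: "(\<lambda>p r. (A p (C r v) + B p (C r v)) - C r (A p v + B p v)) =
      (\<lambda>p r. A p (C r v) - C r (A p v)) - (0 - (\<lambda>q r. B q (C r v) - C r (B q v)))"
      by (auto simp: fun_eq_iff fld_simps assms(1))
    show ?thesis unfolding eq pow_diff[of dz, OF dz_diff]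
      using dz_pow_zero_mono[OF K1, of "max K1 K2" v] dz_pow_zero_mono[OF K2, of "max K1 K2" v]
      by (simp add: pow_zero[of dz, OF dz_diff])
  qed
  then show ?thesis unfolding local_to_def by blast
qed

lemma local_scale:
  assumes "fld C" "local_to A C"
  shows "local_to (\<lambda>n v. sc a (A n v)) C"
proof -
  obtain K1 where K1: "\<And>v. (dz ^^ K1) (\<lambda>p r. A p (C r v) - C r (A p v)) = 0"
    using assms by (auto simp: local_to_def)
  have "(dz ^^ K1) (\<lambda>p r. sc a (A p (C r v)) - C r (sc a (A p v))) p r = 0" for v p r
    using dz_pow_hom[of "sc a" K1 "\<lambda>p r. A p (C r v) - C r (A p v)" p r] K1[of v]
    by (simp add: fld_simps assms(1) scale_right_diff_distrib)
  then show ?thesis unfolding local_to_def by (auto simp: fun_eq_iff)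
qed

section \<open>Translation covariance and the vacuum property of normally ordered products\<close>

definition covariant :: "('w \<Rightarrow> 'w) \<Rightarrow> (int \<Rightarrow> 'w \<Rightarrow> 'w) \<Rightarrow> bool" where
  "covariant T A \<longleftrightarrow> (\<forall>n v. T (A n v) - A n (T v) = sc (- of_int n) (A (n - 1) v))"

definition creative :: "'w \<Rightarrow> (int \<Rightarrow> 'w \<Rightarrow> 'w) \<Rightarrow> bool" where
  "creative vac A \<longleftrightarrow> (\<forall>n\<ge>0. A n vac = 0)"

text \<open>The commutator of T with the derivation d/dz + d/dw on coefficient functions; it commutes with z - w.\<close>

definition tdel :: "('w \<Rightarrow> 'w) \<Rightarrow> (int \<Rightarrow> int \<Rightarrow> 'w) \<Rightarrow> (int \<Rightarrow> int \<Rightarrow> 'w) \<Rightarrow> int \<Rightarrow> int \<Rightarrow> 'w" where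
  "tdel T h k p q = T (h p q) - k p q + sc (of_int p) (h (p - 1) q) + sc (of_int q) (h p (q - 1))"

lemma dz_tdel:
  assumes "module_hom sc sc T"
  shows "dz (tdel T h k) = tdel T (dz h) (dz k)"
  by (auto simp: dz_def tdel_def fun_eq_iff module_hom.diff[OF assms] scale_left_distrib
      scale_right_diff_distrib algebra_simps)

lemma dz_pow_tdel:
  assumes "module_hom sc sc T"
  shows "(dz ^^ n) (tdel T h k) = tdel T ((dz ^^ n) h) ((dz ^^ n) k)"
  by (induction n) (auto simp: dz_tdel[OF assms])

text \<open>Clearing the pole is injective and commutes with \<open>tdel\<close>, so only A(z) B(w)
  has to be checked, where the claim is the Leibniz rule.\<close>

lemma tdel_H1:
  assumes "fld A" "fld B" "module_hom sc sc T" "covariant T A" "covariant T B"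
  shows "tdel T (H1 A B j v) (H1 A B j (T v)) = 0"
proof (rule dz_pow_inj)
  obtain Q1 Q2 where Q: "\<And>p q. q \<ge> Q1 \<Longrightarrow> H1 A B j v p q = 0" "\<And>p q. q \<ge> Q2 \<Longrightarrow> H1 A B j (T v) p q = 0"
    using qtrunc_H1[OF assms(1,2), of j v] qtrunc_H1[OF assms(1,2), of j "T v"]
    by (auto simp: qtrunc_def)
  then show "qtrunc (tdel T (H1 A B j v) (H1 A B j (T v)))"
    unfolding qtrunc_def tdel_def
    by (intro exI[of _ "max (Q1 + 1) Q2"]) (auto simp: module_hom.zero[OF assms(3)])
  have A: "T (A n x) = A n (T x) - sc (of_int n) (A (n - 1) x)"
    and B: "T (B n x) = B n (T x) - sc (of_int n) (B (n - 1) x)" for n x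
    using assms(4,5) by (simp_all add: covariant_def algebra_simps)
  show "(dz ^^ Suc j) (tdel T (H1 A B j v) (H1 A B j (T v))) = 0"
    unfolding dz_pow_tdel[OF assms(3)] dz_pow_H1[OF assms(1,2)]
    by (auto simp: tdel_def fun_eq_iff A B fld_simps assms)
qed

text \<open>At p = 0 the term from d/dz has the factor 0 (a derivative has no residue), and only
  d/dw survives.\<close>

lemma covariant_nop:
  assumes "fld A" "fld B" "module_hom sc sc T" "covariant T A" "covariant T B"
  shows "covariant T (nop sc A B j)"
proof -
  have 1: "tdel T (H1 A B j v) (H1 A B j (T v)) 0 n = 0" 
    and 2: "tdel T (H1 B A j v) (H1 B A j (T v)) n 0 = 0" for v n
    using tdel_H1[OF assms] tdel_H1[OF assms(2,1,3,5,4)] by simp_all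
  have "T (HH A B j v 0 n) - HH A B j (T v) 0 n = sc (- of_int n) (HH A B j v 0 (n - 1))" for v n
  proof -
    have a: "T (H1 A B j v 0 n) = H1 A B j (T v) 0 n - sc (of_int n) (H1 A B j v 0 (n - 1))"
      using 1[of v n] by (simp add: tdel_def algebra_simps)
    have b: "T (H1 B A j v n 0) = H1 B A j (T v) n 0 - sc (of_int n) (H1 B A j v (n - 1) 0)"
      using 2[of v n] by (simp add: tdel_def algebra_simps)
    show ?thesis
      by (simp add: HH_def a b module_hom.add[OF assms(3)] module_hom.scale[OF assms(3)]
          scale_right_diff_distrib scale_right_distrib algebra_simps)
  qed
  then show ?thesis by (simp add: covariant_def nop_eq[OF assms(1,2)])
qed

lemma creative_nop:
  assumes "fld A" "fld B" "creative vac A" "creative vac B"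
  shows "creative vac (nop sc A B j)"
  unfolding creative_def
proof (intro allI impI)
  fix n :: int assume "n \<ge> 0"
  then have "nop_term sc A B j n vac i = 0" for i
    using assms by (simp add: creative_def nop_term_def fld_0)
  then show "nop sc A B j n vac = 0" by (simp add: nop_def)
qed

lemma nop_vac:
  assumes "fld A" "fld B" "creative vac A" "creative vac B"
  shows "nop sc A B j (- 1) vac = A (- int j - 1) (B (- 1) vac)"
proof -
  have "nop sc A B j (- 1) vac = (\<Sum>i<Suc 0. nop_term sc A B j (- 1) vac i)"
    by (rule nop_eq_sum[OF assms(1,2)]) (use assms(3,4) in \<open>auto simp: creative_def\<close>)
  then show ?thesis
    using assms(3,4) by (simp add: nop_term_def creative_def fld_0[OF assms(2)])
qed

definition good :: "('w \<Rightarrow> 'w) \<Rightarrow> 'w \<Rightarrow> (int \<Rightarrow> 'w \<Rightarrow> 'w) \<Rightarrow> bool" where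
  "good T vac A \<longleftrightarrow> fld A \<and> covariant T A \<and> creative vac A"

lemma good_nop: "module_hom sc sc T \<Longrightarrow> good T vac A \<Longrightarrow> good T vac B \<Longrightarrow> good T vac (nop sc A B j)"
  by (simp add: good_def fld_nop covariant_nop creative_nop)

lemma good_add:
  assumes "module_hom sc sc T" "good T vac A" "good T vac B"
  shows "good T vac (\<lambda>n v. A n v + B n v)"
  unfolding good_def
proof (intro conjI)
  note A = assms(2)[unfolded good_def] and B = assms(3)[unfolded good_def]
  show "fld (\<lambda>n v. A n v + B n v)"
    unfolding fld_def
  proof (intro conjI allI)
    show "module_hom sc sc (\<lambda>v. A n v + B n v)" for n
      by (rule hom_intro) (use A B in \<open>auto simp: fld_simps scale_right_distrib\<close>)
    fix v
    obtain M N where "\<And>n. n \<ge> M \<Longrightarrow> A n v = 0" "\<And>n. n \<ge> N \<Longrightarrow> B n v = 0"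
      using A B fld_bound by metis
    then show "\<exists>N. \<forall>n\<ge>N. A n v + B n v = 0" by (intro exI[of _ "max M N"]) auto
  qed
  show "covariant T (\<lambda>n v. A n v + B n v)"
    using A B by (simp add: covariant_def module_hom.add[OF assms(1)] scale_right_distrib algebra_simps)
  show "creative vac (\<lambda>n v. A n v + B n v)"
    using A B by (simp add: creative_def)
qed

lemma good_scale:
  assumes "module_hom sc sc T" "good T vac A"
  shows "good T vac (\<lambda>n v. sc a (A n v))"
  unfolding good_def
proof (intro conjI)
  note A = assms(2)[unfolded good_def]
  show "fld (\<lambda>n v. sc a (A n v))"
    unfolding fld_def
  proof (intro conjI allI)
    show "module_hom sc sc (\<lambda>v. sc a (A n v))" for n
      by (rule hom_intro) (use A in \<open>auto simp: fld_simps scale_right_distrib mult.commute\<close>)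
    fix v
    obtain M where "\<And>n. n \<ge> M \<Longrightarrow> A n v = 0"
      using A fld_bound by metis
    then show "\<exists>N. \<forall>n\<ge>N. sc a (A n v) = 0" by (intro exI[of _ M]) auto
  qed
  have "T (A n v) = A n (T v) - sc (of_int n) (A (n - 1) v)" for n v
    using A by (simp add: covariant_def algebra_simps)
  then have "sc a (T (A n v)) = sc a (A n (T v)) - sc (a * of_int n) (A (n - 1) v)" for n v
    by (simp only: scale_right_diff_distrib scale_scale)
  then show "covariant T (\<lambda>n v. sc a (A n v))"
    by (simp add: covariant_def module_hom.scale[OF assms(1)] mult.commute)
  show "creative vac (\<lambda>n v. sc a (A n v))"
    using A by (simp add: creative_def)
qed

lemma good_derivative_vac:
  assumes "good T vac A" "T vac = 0"
  shows "T (A n vac) = sc (- of_int n) (A (n - 1) vac)"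
  using assms fld_0[of A n] by (simp add: good_def covariant_def) (metis diff_zero)

text \<open>Uniqueness in the style of Goddard: a field local to B and vanishing on v vanishes on all
  B n v, because locality becomes a vanishing difference of a truncated function.\<close>

lemma local_vanish:
  assumes "fld A" "fld B" "local_to A B" "\<And>n. A n v = 0"
  shows "A m (B n v) = 0"
proof -
  obtain K where K: "(dz ^^ K) (\<lambda>p q. A p (B q v) - B q (A p v)) = 0"
    using assms(3) by (auto simp: local_to_def)
  then have "(dz ^^ K) (\<lambda>p q. A p (B q v)) = 0" by (simp add: assms(4) fld_0 assms(2))
  moreover obtain N where "\<And>n. n \<ge> N \<Longrightarrow> B n v = 0" using fld_bound[OF assms(2)] by blast
  then have "qtrunc (\<lambda>p q. A p (B q v))" unfolding qtrunc_def
    by (intro exI[of _ N]) (auto simp: fld_0 assms(1))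
  ultimately have "(\<lambda>p q. A p (B q v)) = 0" by (rule dz_pow_inj[rotated])
  then show ?thesis by (metis zero_fun_apply)
qed

end

section \<open>The tensor square of the Virasoro vertex algebra\<close>

locale vir_square = vertex_fields sc
  for sc :: "complex \<Rightarrow> 'w::ab_group_add \<Rightarrow> 'w" +
  fixes c :: complex and vac :: 'w and L1 L2 :: "int \<Rightarrow> 'w \<Rightarrow> 'w"
  assumes square: "vir_tensor_square sc c vac L1 L2"
begin

text \<open>The swap acts on X e by (-1)^e.\<close>

definition X :: "bool \<Rightarrow> int \<Rightarrow> 'w \<Rightarrow> 'w" where
  "X e n v = (if e then L1 n v - L2 n v else L1 n v + L2 n v)"

lemma hom_L: "module_hom sc sc (L1 n)" "module_hom sc sc (L2 n)"
  using square by (auto simp: vir_tensor_square_def linear_iff_module_hom)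

lemmas L_simps = module_hom.add[OF hom_L(1)] module_hom.add[OF hom_L(2)]
  module_hom.diff[OF hom_L(1)] module_hom.diff[OF hom_L(2)]
  module_hom.scale[OF hom_L(1)] module_hom.scale[OF hom_L(2)]
  module_hom.zero[OF hom_L(1)] module_hom.zero[OF hom_L(2)]

lemma L1_comm: "L1 m (L1 n v) = L1 n (L1 m v) + sc (of_int (m - n)) (L1 (m + n) v)
        + (if m + n = 0 then sc (c / 12 * of_int (m ^ 3 - m)) v else 0)"
  and L2_comm: "L2 m (L2 n v) = L2 n (L2 m v) + sc (of_int (m - n)) (L2 (m + n) v)
        + (if m + n = 0 then sc (c / 12 * of_int (m ^ 3 - m)) v else 0)"
  and L12_comm: "L1 m (L2 n v) = L2 n (L1 m v)"
proof -
  have "vir_rel sc c L1" "vir_rel sc c L2" "L1 m (L2 n v) = L2 n (L1 m v)"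
    using square by (auto simp: vir_tensor_square_def)
  then show "L1 m (L1 n v) = L1 n (L1 m v) + sc (of_int (m - n)) (L1 (m + n) v)
        + (if m + n = 0 then sc (c / 12 * of_int (m ^ 3 - m)) v else 0)"
    "L2 m (L2 n v) = L2 n (L2 m v) + sc (of_int (m - n)) (L2 (m + n) v)
        + (if m + n = 0 then sc (c / 12 * of_int (m ^ 3 - m)) v else 0)"
    "L1 m (L2 n v) = L2 n (L1 m v)"
    unfolding vir_rel_def by (metis add.commute diff_add_cancel add.assoc)+
qed

lemma L_vac: "n \<ge> -1 \<Longrightarrow> L1 n vac = 0" "n \<ge> -1 \<Longrightarrow> L2 n vac = 0"
  using square by (auto simp: vir_tensor_square_def)

lemma hom_X: "module_hom sc sc (X e n)"
  by (rule hom_intro) (auto simp: X_def L_simps scale_right_distrib scale_right_diff_distrib)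

lemmas X_simps = module_hom.add[OF hom_X] module_hom.diff[OF hom_X] module_hom.scale[OF hom_X]
  module_hom.zero[OF hom_X] module_hom.sum[OF hom_X] module_hom.neg[OF hom_X]

text \<open>\<open>e \<noteq> f\<close> is exclusive or: brackets respect the grading by parity. For
  e = f the central terms of the two factors add up to c/6, otherwise they cancel.\<close>

lemma X_comm: "X e m (X f n v) = X f n (X e m v) + sc (of_int (m - n)) (X (e \<noteq> f) (m + n) v)
        + (if e = f \<and> m + n = 0 then sc (c / 6 * of_int (m ^ 3 - m)) v else 0)"
proof -
  have h: "sc (c / 6 * of_int (m ^ 3 - m)) v = sc (c / 12 * of_int (m ^ 3 - m)) v + sc (c / 12 * of_int (m ^ 3 - m)) v"
    unfolding scale_left_distrib[symmetric] by (simp add: field_simps)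
  have h0: "L1 m (L2 n v) = L2 n (L1 m v)" "L2 m (L1 n v) = L1 n (L2 m v)" by (simp_all add: L12_comm)
  show ?thesis
    unfolding X_def L_simps h
    by (cases e; cases f; cases "m + n = 0")
       (simp_all add: L_simps h0 L1_comm[of m n] L2_comm[of m n] scale_right_distrib
         scale_right_diff_distrib algebra_simps del: of_int_diff)
qed

lemma X_vac: "n \<ge> -1 \<Longrightarrow> X e n vac = 0"
  by (simp add: X_def L_vac)

lemma L1_X: "L1 n v = sc (1 / 2) (X False n v + X True n v)"
  and L2_X: "L2 n v = sc (1 / 2) (X False n v - X True n v)"
proof -
  have h: "x = sc (1 / 2) (x + x)" for x
    unfolding scale_right_distrib scale_left_distrib[symmetric] by simp
  have "X False n v + X True n v = L1 n v + L1 n v" "X False n v - X True n v = L2 n v + L2 n v"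
    by (simp_all add: X_def)
  then show "L1 n v = sc (1 / 2) (X False n v + X True n v)"
    "L2 n v = sc (1 / 2) (X False n v - X True n v)"
    using h[of "L1 n v"] h[of "L2 n v"] by simp_all
qed

lemma W_induct:
  assumes "subspace {v. P v}" "P vac" "\<And>e n v. P v \<Longrightarrow> P (X e n v)"
  shows "P v"
proof -
  have L: "P (L1 n v)" "P (L2 n v)" if "P v" for n v
    using subspace_scale[OF assms(1), of _ "1 / 2"] subspace_add[OF assms(1)] subspace_diff[OF assms(1)] assms(3)[OF that]
    by (simp_all add: L1_X L2_X)
  have "P (pbw_mono L1 L2 vac mn)" for mn
  proof -
    obtain ms ns where mn: "mn = (ms, ns)" by (cases mn)
    have "P (foldr L2 ns vac)" by (induction ns) (auto simp: assms L)
    then have "P (foldr L1 ms (foldr L2 ns vac))" by (induction ms) (auto simp: assms L)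
    then show ?thesis by (simp add: mn pbw_mono_def)
  qed
  then have "span (pbw_mono L1 L2 vac ` pbw_index) \<subseteq> {v. P v}"
    by (intro span_minimal) (use assms(1) in auto)
  moreover have "span (pbw_mono L1 L2 vac ` pbw_index) = UNIV"
    using square by (auto simp: vir_tensor_square_def)
  ultimately show ?thesis by auto
qed

definition T :: "'w \<Rightarrow> 'w" where "T = X False (-1)"

lemma hom_T: "module_hom sc sc T"
  by (simp add: T_def hom_X)

lemma T_vac: "T vac = 0"
  by (simp add: T_def X_vac)

definition XF :: "bool \<Rightarrow> int \<Rightarrow> 'w \<Rightarrow> 'w" where "XF e p = X e (p - 1)"
definition Lf1 :: "int \<Rightarrow> 'w \<Rightarrow> 'w" where "Lf1 p = L1 (p - 1)"
definition Lf2 :: "int \<Rightarrow> 'w \<Rightarrow> 'w" where "Lf2 p = L2 (p - 1)"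
definition idf :: "int \<Rightarrow> 'w \<Rightarrow> 'w" where "idf n v = (if n = -1 then v else 0)"

lemma X_eventually_0: "\<exists>N. \<forall>n\<ge>N. X e n v = 0"
proof -
  \<comment> \<open>Both parities share a bound because commuting past \<open>X f m\<close> turns
    \<open>X e\<close> into \<open>X (e \<noteq> f)\<close>.\<close>
  have "\<exists>N. \<forall>e. \<forall>n\<ge>N. X e n v = 0"
  proof (induction v rule: W_induct)
    case 1
    show ?case
    proof (rule subspaceI)
      fix x y assume "x \<in> {v. \<exists>N. \<forall>e. \<forall>n\<ge>N. X e n v = 0}" "y \<in> {v. \<exists>N. \<forall>e. \<forall>n\<ge>N. X e n v = 0}"
      then obtain M N where "\<forall>e. \<forall>n\<ge>M. X e n x = 0" "\<forall>e. \<forall>n\<ge>N. X e n y = 0" by auto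
      then have "\<forall>e. \<forall>n\<ge>max M N. X e n (x + y) = 0" by (auto simp: X_simps)
      then show "x + y \<in> {v. \<exists>N. \<forall>e. \<forall>n\<ge>N. X e n v = 0}" by blast
    next
      fix a x assume "x \<in> {v. \<exists>N. \<forall>e. \<forall>n\<ge>N. X e n v = 0}"
      then obtain M where "\<forall>e. \<forall>n\<ge>M. X e n x = 0" by auto
      then have "\<forall>e. \<forall>n\<ge>M. X e n (sc a x) = 0" by (auto simp: X_simps)
      then show "sc a x \<in> {v. \<exists>N. \<forall>e. \<forall>n\<ge>N. X e n v = 0}" by blast
    qed (auto simp: X_simps)
  next
    case 2
    then show ?case by (intro exI[of _ "-1"]) (auto simp: X_vac)
  next
    case (3 f m v)
    then obtain N where "\<And>e n. n \<ge> N \<Longrightarrow> X e n v = 0" by auto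
    then show ?case
      by (intro exI[of _ "max N (max (N - m) (1 - m))"]) (auto simp: X_comm[of _ _ f m] X_simps)
  qed
  then show ?thesis by blast
qed

lemma L_eventually_0: "\<exists>N. \<forall>n\<ge>N. L1 n v = 0 \<and> L2 n v = 0"
proof -
  obtain M N where "\<forall>n\<ge>M. X False n v = 0" "\<forall>n\<ge>N. X True n v = 0"
    using X_eventually_0 by metis
  then show ?thesis by (intro exI[of _ "max M N"]) (auto simp: L1_X L2_X)
qed

lemma good_Lf: "good T vac Lf1" "good T vac Lf2"
proof -
  have "fld Lf1" "fld Lf2"
    unfolding fld_def Lf1_def Lf2_def
  proof (safe)
    fix v
    obtain N where N: "\<forall>n\<ge>N. L1 n v = 0 \<and> L2 n v = 0" using L_eventually_0 by blast
    then show "\<exists>N. \<forall>n\<ge>N. L1 (n - 1) v = 0" by (intro exI[of _ "N + 1"]) auto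
    from N show "\<exists>N. \<forall>n\<ge>N. L2 (n - 1) v = 0" by (intro exI[of _ "N + 1"]) auto
  qed (auto simp: hom_L)
  moreover have "covariant T Lf1" "covariant T Lf2"
    unfolding covariant_def T_def X_def Lf1_def Lf2_def
    by (auto simp: L_simps L1_comm[of "-1" "_ - 1"] L2_comm[of "-1" "_ - 1"] L12_comm algebra_simps)
  moreover have "creative vac Lf1" "creative vac Lf2"
    unfolding creative_def by (simp_all add: Lf1_def Lf2_def L_vac)
  ultimately show "good T vac Lf1" "good T vac Lf2" by (auto simp: good_def)
qed

lemma good_idf: "good T vac idf"
  unfolding good_def fld_def covariant_def creative_def idf_def
proof (intro conjI allI)
  fix v :: 'w
  show "\<exists>N. \<forall>n\<ge>N::int. (if n = - 1 then v else 0) = 0"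
    by (intro exI[of _ 0]) auto
qed (auto intro!: hom_intro simp: module_hom.zero[OF hom_T])

lemma local_idf: "fld A \<Longrightarrow> local_to idf A"
  unfolding local_to_def by (rule exI[of _ 0]) (auto simp: idf_def fun_eq_iff fld_0)

text \<open>A factor depending on p + q alone is only shifted by z - w, so all differences fall on
  F, and a polynomial F dies after finitely many of them.\<close>

lemma dz_pow_sc:
  "(dz ^^ n) (\<lambda>p q. sc (F p q) (g (p + q))) p q = sc ((dz ^^ n) F p q) (g (p + q + int n))"
  by (induction n arbitrary: p q) (auto simp: dz_def scale_left_diff_distrib add_ac)

text \<open>The coefficients of the commutator are polynomials of degree at most three, the cubic
  one being the central term, so fourth differences vanish.\<close>

lemma local_L_aux:
  assumes "\<And>m n v. L m (L n v) = L n (L m v) + sc (of_int (m - n)) (L (m + n) v)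
        + (if m + n = 0 then sc (c / 12 * of_int (m ^ 3 - m)) v else 0)"
  shows "local_to (\<lambda>p. L (p - 1)) (\<lambda>p. L (p - 1))"
proof -
  have "(dz ^^ 4) (\<lambda>p q. L (p - 1) (L (q - 1) v) - L (q - 1) (L (p - 1) v)) = 0" for v
  proof -
    define g where "g s = L (s - 2) v" for s
    define k where "k s = (if s = 2 then v else 0)" for s :: int
    have *: "L (p - 1) (L (q - 1) v) - L (q - 1) (L (p - 1) v)
      = sc (of_int (p - q)) (g (p + q)) + sc (c / 12 * of_int ((p - 1) ^ 3 - (p - 1))) (k (p + q))" for p q
      using assms[of "p - 1" "q - 1" v] by (auto simp: g_def k_def algebra_simps)
    have F: "(dz ^^ 4) (\<lambda>p q. of_int (p - q) :: complex) p q = 0"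
      "(dz ^^ 4) (\<lambda>p q. c / 12 * of_int ((p - 1) ^ 3 - (p - 1))) p q = 0" for p q
      by (simp_all add: eval_nat_numeral dz_def field_simps)
    have "(dz ^^ 4) (\<lambda>p q. sc (of_int (p - q)) (g (p + q))
        - (- sc (c / 12 * of_int ((p - 1) ^ 3 - (p - 1))) (k (p + q)))) = 0"
      unfolding pow_diff[of dz, OF dz_diff, unfolded fun_diff_def] using dz_pow_sc[of 4 _ g] dz_pow_sc[of 4 _ "\<lambda>s. - k s"]
      by (simp only: F scale_zero_left fun_eq_iff scale_minus_right[symmetric]) simp
    then show ?thesis unfolding * by simp
  qed
  then show ?thesis unfolding local_to_def by blast
qed

lemma local_L: "local_to Lf1 Lf1" "local_to Lf2 Lf2" "local_to Lf1 Lf2"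
proof -
  show "local_to Lf1 Lf1" using local_L_aux[of L1, OF L1_comm] by (simp add: Lf1_def[abs_def])
  show "local_to Lf2 Lf2" using local_L_aux[of L2, OF L2_comm] by (simp add: Lf2_def[abs_def])
  show "local_to Lf1 Lf2" unfolding local_to_def
    by (rule exI[of _ 0]) (auto simp: Lf1_def Lf2_def fun_eq_iff L12_comm)
qed

section \<open>Mutually local fields generated by the two Virasoro fields, and their
  uniqueness\<close>

fun FFs :: "nat \<Rightarrow> (int \<Rightarrow> 'w \<Rightarrow> 'w) set" where
  "FFs 0 = {Lf1, Lf2, idf}"
| "FFs (Suc n) = FFs n \<union> {nop sc A B j | A B j. A \<in> FFs n \<and> B \<in> FFs n}
     \<union> {\<lambda>n v. A n v + B n v | A B. A \<in> FFs n \<and> B \<in> FFs n} \<union> {\<lambda>n v. sc a (A n v) | a A. A \<in> FFs n}"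

lemma FFs_good: "A \<in> FFs n \<Longrightarrow> good T vac A"
  by (induction n arbitrary: A) (auto simp: good_Lf good_idf good_nop good_add good_scale hom_T)

lemma FFs_fld: "A \<in> FFs n \<Longrightarrow> fld A"
  using FFs_good by (auto simp: good_def)

text \<open>Dong's lemma extends only one argument at a time. \<open>step\<close> first makes B
  local to all fields of the previous stage; by symmetry these are local to B, and
  \<open>step\<close> applies again with B as the second argument.\<close>

lemma FFs_local: "A \<in> FFs n \<Longrightarrow> B \<in> FFs n \<Longrightarrow> local_to A B"
proof (induction n arbitrary: A B)
  case 0
  have "fld Lf1" "fld Lf2" "fld idf" using FFs_fld[of _ 0] by auto
  then show ?case using 0 local_L local_L[THEN local_to_sym] local_idf local_idf[THEN local_to_sym]
    by auto
next
  case (Suc n)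
  have step: "local_to X C" if C: "fld C" "\<And>A. A \<in> FFs n \<Longrightarrow> local_to A C" and X: "X \<in> FFs (Suc n)" for X C
  proof -
    have old: "local_to A C" "fld A" if "A \<in> FFs n" for A using C that FFs_fld by auto
    from X consider "X \<in> FFs n" | A B j where "X = nop sc A B j" "A \<in> FFs n" "B \<in> FFs n"
      | A B where "X = (\<lambda>n v. A n v + B n v)" "A \<in> FFs n" "B \<in> FFs n"
      | A a where "X = (\<lambda>n v. sc a (A n v))" "A \<in> FFs n" by auto
    then show ?thesis
    proof cases
      case 2
      then show ?thesis using local_nop[of A B C j] Suc.IH[of A B] old C(1) by simp
    qed (use old C local_add local_scale in simp_all)
  qed
  have "local_to B C" if "C \<in> FFs n" for C
    by (rule step[OF _ _ Suc.prems(2)]) (use that Suc.IH FFs_fld in auto)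
  then have "local_to C B" if "C \<in> FFs n" for C using that local_to_sym by blast
  then show ?case
    by (rule step[OF FFs_fld[OF Suc.prems(2)] _ Suc.prems(1)])
qed

definition FF :: "(int \<Rightarrow> 'w \<Rightarrow> 'w) \<Rightarrow> bool" where "FF A \<longleftrightarrow> (\<exists>n. A \<in> FFs n)"

lemma FFs_mono: "m \<le> n \<Longrightarrow> FFs m \<subseteq> FFs n"
  by (rule lift_Suc_mono_le[of FFs]) auto

lemma FF_pair: assumes "FF A" "FF B" shows "\<exists>n. A \<in> FFs n \<and> B \<in> FFs n"
proof -
  from assms obtain m n where "A \<in> FFs m" "B \<in> FFs n" by (auto simp: FF_def)
  then show ?thesis using FFs_mono[of m "max m n"] FFs_mono[of n "max m n"] by auto
qed

lemma FF_good: "FF A \<Longrightarrow> good T vac A"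
  and FF_fld: "FF A \<Longrightarrow> fld A"
  using FFs_good FFs_fld by (auto simp: FF_def)

lemma FF_local: "FF A \<Longrightarrow> FF B \<Longrightarrow> local_to A B"
  using FF_pair FFs_local by blast

lemma FF_nop: assumes "FF A" "FF B" shows "FF (nop sc A B j)"
proof -
  obtain n where "A \<in> FFs n" "B \<in> FFs n" using FF_pair[OF assms] by blast
  then have "nop sc A B j \<in> FFs (Suc n)" by (simp, blast)
  then show ?thesis unfolding FF_def by blast
qed

lemma FF_add: assumes "FF A" "FF B" shows "FF (\<lambda>n v. A n v + B n v)"
proof -
  obtain n where "A \<in> FFs n" "B \<in> FFs n" using FF_pair[OF assms] by blast
  then have "(\<lambda>n v. A n v + B n v) \<in> FFs (Suc n)" by (simp, blast)
  then show ?thesis unfolding FF_def by blast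
qed

lemma FF_scale: assumes "FF A" shows "FF (\<lambda>n v. sc a (A n v))"
proof -
  obtain n where "A \<in> FFs n" using assms FF_def by blast
  then have "(\<lambda>n v. sc a (A n v)) \<in> FFs (Suc n)" by (simp, blast)
  then show ?thesis unfolding FF_def by blast
qed

lemma FF_base: "FF Lf1" "FF Lf2" "FF idf"
  unfolding FF_def by (rule exI[of _ 0], simp)+

lemma FF_diff: assumes "FF A" "FF B" shows "FF (\<lambda>n v. A n v - B n v)"
  using FF_add[OF assms(1) FF_scale[OF assms(2), of "-1"]] by simp

lemma FF_XF: "FF (XF e)"
proof -
  have "XF e = (if e then (\<lambda>n v. Lf1 n v - Lf2 n v) else (\<lambda>n v. Lf1 n v + Lf2 n v))"
    by (auto simp: XF_def X_def Lf1_def Lf2_def fun_eq_iff)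
  then show ?thesis using FF_add[OF FF_base(1,2)] FF_diff[OF FF_base(1,2)] by auto
qed

text \<open>Translation covariance spreads A (-1) vac = 0 to all negative modes on the vacuum, the
  vacuum property covers the others, and locality carries the vanishing along the modes of l and x
  to every state.\<close>

lemma FF_zero:
  assumes "FF A" "A (- 1) vac = 0"
  shows "A n v = 0"
proof -
  note g = FF_good[OF assms(1)]
  have neg: "A (- int k - 1) vac = 0" for k
  proof (induction k)
    case (Suc k)
    have "T (A (- int k - 1) vac) = sc (of_nat (Suc k)) (A (- int (Suc k) - 1) vac)"
      using good_derivative_vac[OF g T_vac, of "- int k - 1"] by (simp add: algebra_simps)
    then have "sc (of_nat (Suc k)) (A (- int (Suc k) - 1) vac) = 0"
      using Suc module_hom.zero[OF hom_T] by simp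
    then show ?case using of_nat_neq_0[of k, where 'a=complex] by (metis scale_eq_0_iff)
  qed (use assms(2) in simp)
  have "\<forall>n. A n v = 0"
  proof (induction v rule: W_induct)
    case 1
    show ?case by (rule subspaceI) (auto simp: fld_simps FF_fld[OF assms(1)])
  next
    case 2
    show ?case
    proof
      fix n :: int
      show "A n vac = 0"
      proof (cases "n \<ge> 0")
        case True
        then show ?thesis using g by (auto simp: good_def creative_def)
      next
        case False
        then show ?thesis using neg[of "nat (- n - 1)"] by simp
      qed
    qed
  next
    case (3 e m v)
    then have "A n (XF e (m + 1) v) = 0" for n
      by (intro local_vanish[where v=v, OF FF_fld[OF assms(1)] FF_fld[OF FF_XF] FF_local[OF assms(1) FF_XF]]) auto
    then show ?case by (simp add: XF_def)
  qed
  then show ?thesis by blast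
qed

lemma FF_unique:
  assumes "FF A" "FF B" "A (- 1) vac = B (- 1) vac"
  shows "A n v = B n v"
  using FF_zero[OF FF_diff[OF assms(1,2)], of n v] assms(3) by simp

subsection \<open>Words, weights and the length filtration\<close>

definition word :: "(bool \<times> int) list \<Rightarrow> 'w" where
  "word ls = foldr (\<lambda>(e, a) v. X e (- a) v) ls vac"

definition parity :: "(bool \<times> int) list \<Rightarrow> bool" where
  "parity ls = foldr (\<lambda>(e, a) p. e \<noteq> p) ls False"

text \<open>Letters are left unordered, and the length is bounded instead of fixed: commutators
  shorten words, so the spans form a filtration on which to induct.\<close>

definition words :: "nat \<Rightarrow> int \<Rightarrow> bool \<Rightarrow> (bool \<times> int) list set" where
  "words k N e = {ls. (\<forall>x\<in>set ls. snd x \<ge> 2) \<and> length ls \<le> k \<and> sum_list (map snd ls) = N \<and> parity ls = e}"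

definition F :: "nat \<Rightarrow> int \<Rightarrow> bool \<Rightarrow> 'w set" where
  "F k N e = span (word ` words k N e)"

definition E :: "int \<Rightarrow> bool \<Rightarrow> 'w set" where
  "E N e = (\<Union>k. F k N e)"

lemma word_simps [simp]: "word [] = vac" "word ((e, a) # ls) = X e (- a) (word ls)"
  "parity [] = False" "parity ((e, a) # ls) = (e \<noteq> parity ls)"
  by (simp_all add: word_def parity_def)

lemma hom_span:
  assumes "module_hom sc sc f" "\<And>x. x \<in> B \<Longrightarrow> f x \<in> span C" "v \<in> span B"
  shows "f v \<in> span C"
  using assms(3)
proof (induction rule: span_induct_alt)
  case base
  then show ?case by (simp add: module_hom.zero[OF assms(1)] span_zero)
next
  case (step a x y)
  then show ?case
    by (simp add: module_hom.add[OF assms(1)] module_hom.scale[OF assms(1)] span_add span_scale assms(2))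
qed

lemma F_mono: "k \<le> k' \<Longrightarrow> F k N e \<subseteq> F k' N e"
  unfolding F_def by (intro span_mono image_mono) (auto simp: words_def)

lemma F_cong: "v \<in> F k N e \<Longrightarrow> N = N' \<Longrightarrow> e = e' \<Longrightarrow> v \<in> F k N' e'"
  by simp

lemma F_subspace: "subspace (F k N e)"
  by (simp add: F_def)

lemmas F_closed = subspace_add[OF F_subspace] subspace_scale[OF F_subspace] subspace_0[OF F_subspace]
  subspace_sum[OF F_subspace]

lemma word_F: "\<forall>x\<in>set ls. snd x \<ge> 2 \<Longrightarrow> word ls \<in> F (length ls) (sum_list (map snd ls)) (parity ls)"
  unfolding F_def by (intro span_base imageI) (auto simp: words_def)

lemma F_create:
  assumes "a \<ge> 2" "v \<in> F k N e"
  shows "X f (- a) v \<in> F (Suc k) (N + a) (f \<noteq> e)"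
  using assms(2) unfolding F_def
proof (rule hom_span[OF hom_X, rotated])
  fix x assume "x \<in> word ` words k N e"
  then obtain ls where "ls \<in> words k N e" "x = word ls" by auto
  then have "(f, a) # ls \<in> words (Suc k) (N + a) (f \<noteq> e)" "X f (- a) x = word ((f, a) # ls)"
    using assms(1) by (auto simp: words_def)
  then show "X f (- a) x \<in> span (word ` words (Suc k) (N + a) (f \<noteq> e))"
    by (metis span_base image_eqI)
qed

lemma F_create': "m \<le> -2 \<Longrightarrow> v \<in> F k N e \<Longrightarrow> X f m v \<in> F (Suc k) (N - m) (f \<noteq> e)"
  using F_create[of "- m" v k N e f] by simp

text \<open>Commuting \<open>X f n\<close> to the right replaces a letter by a single letter or by a
  scalar, and the vacuum is killed at the end. So modes with n \<ge> -1 do not lengthen words; this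
  is what makes the corrections in normally ordered products short.\<close>

lemma word_annihilate:
  assumes "\<forall>x\<in>set ls. snd x \<ge> 2" "n \<ge> -1"
  shows "X f n (word ls) \<in> F (length ls) (sum_list (map snd ls) - n) (f \<noteq> parity ls)"
  using assms
proof (induction ls arbitrary: f n)
  case Nil
  then show ?case by (simp add: X_vac F_closed)
next
  case (Cons x ls)
  obtain e a where x: "x = (e, a)" by (cases x)
  define N where "N = sum_list (map snd ls)"
  have a: "a \<ge> 2" and w: "word ls \<in> F (length ls) N (parity ls)"
    using Cons.prems x word_F[of ls] by (auto simp: N_def)
  have IH: "X f n (word ls) \<in> F (length ls) (N - n) (f \<noteq> parity ls)" if "n \<ge> -1" for f n
    using Cons.IH[OF _ that] Cons.prems by (simp add: N_def)
  have 1: "X e (- a) (X f n (word ls)) \<in> F (Suc (length ls)) (N - n + a) (f \<noteq> (e \<noteq> parity ls))"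
    by (rule F_cong[OF F_create[OF a IH[OF Cons.prems(2), of f], of e]]) auto
  have 2: "X (f \<noteq> e) (n - a) (word ls) \<in> F (Suc (length ls)) (N - n + a) (f \<noteq> (e \<noteq> parity ls))"
  proof (cases "n - a \<ge> -1")
    case True
    have "X (f \<noteq> e) (n - a) (word ls) \<in> F (Suc (length ls)) (N - (n - a)) ((f \<noteq> e) \<noteq> parity ls)"
      by (rule subsetD[OF F_mono IH[OF True]]) simp
    then show ?thesis by (rule F_cong) auto
  next
    case False
    then have "n - a \<le> -2" by simp
    from F_create'[OF this w, of "f \<noteq> e"] show ?thesis by (rule F_cong) auto
  qed
  have 3: "word ls \<in> F (Suc (length ls)) (N - n + a) (f \<noteq> (e \<noteq> parity ls))" if "f = e" "n = a"
    using w F_mono[of "length ls" "Suc (length ls)" N "parity ls"] that by auto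
  have "X f n (word (x # ls)) \<in> F (Suc (length ls)) (N - n + a) (f \<noteq> (e \<noteq> parity ls))"
    unfolding x word_simps X_comm[of f n e "- a"]
    using 1 2 3 by (auto intro!: F_closed)
  then have "X f n (word (x # ls)) \<in> F (length (x # ls)) (N - n + a) (f \<noteq> (e \<noteq> parity ls))"
    by simp
  then show ?case by (rule F_cong) (auto simp: x N_def)
qed

lemma F_annihilate:
  assumes "n \<ge> -1" "v \<in> F k N e"
  shows "X f n v \<in> F k (N - n) (f \<noteq> e)"
proof -
  have "X f n v \<in> span (word ` words k (N - n) (f \<noteq> e))"
  proof (rule hom_span[OF hom_X])
    show "v \<in> span (word ` words k N e)" using assms(2) by (simp add: F_def)
    fix x assume "x \<in> word ` words k N e"
    then obtain ls where ls: "ls \<in> words k N e" "x = word ls" by auto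
    then have "X f n x \<in> F (length ls) (N - n) (f \<noteq> e)"
      using word_annihilate[of ls n f] assms(1) by (auto simp: words_def)
    then show "X f n x \<in> span (word ` words k (N - n) (f \<noteq> e))"
      using F_mono[of "length ls" k] ls(1) unfolding F_def words_def by blast
  qed
  then show ?thesis by (simp add: F_def)
qed

lemma F_X: "v \<in> F k N e \<Longrightarrow> X f n v \<in> F (Suc k) (N - n) (f \<noteq> e)"
  using F_create'[of n v k N e f] F_annihilate[of n v k N e f] F_mono[of k "Suc k" "N - n" "f \<noteq> e"]
  by (cases "n \<le> -2") auto

lemma words_wt: "\<forall>x\<in>set ls. snd x \<ge> (2::int) \<Longrightarrow> sum_list (map snd ls) \<ge> 2 * int (length ls)"
  by (induction ls) auto

lemma F_neg: assumes "N < 0" "v \<in> F k N e" shows "v = 0"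
proof -
  have "words k N e = {}" using words_wt assms(1) by (fastforce simp: words_def)
  then show ?thesis using assms(2) by (simp add: F_def)
qed

lemma E_subspace: "subspace (E N e)"
proof (rule subspaceI)
  fix x y assume "x \<in> E N e" "y \<in> E N e"
  then obtain k l where "x \<in> F k N e" "y \<in> F l N e" by (auto simp: E_def)
  then have "x \<in> F (max k l) N e" "y \<in> F (max k l) N e"
    using F_mono[of k "max k l" N e] F_mono[of l "max k l" N e] by auto
  then show "x + y \<in> E N e" unfolding E_def by (intro UN_I[of "max k l"] F_closed(1)) auto
qed (use F_closed(2,3) in \<open>force simp: E_def\<close>)+

lemmas E_closed = subspace_add[OF E_subspace] subspace_scale[OF E_subspace] subspace_0[OF E_subspace]
  subspace_sum[OF E_subspace] subspace_diff[OF E_subspace]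

lemma E_X: assumes "v \<in> E N e" shows "X f n v \<in> E (N - n) (f \<noteq> e)"
proof -
  obtain k where "v \<in> F k N e" using assms by (auto simp: E_def)
  from F_X[OF this, of f n] show ?thesis unfolding E_def by (intro UN_I[of "Suc k"]) auto
qed

lemma E_neg: "N < 0 \<Longrightarrow> v \<in> E N e \<Longrightarrow> v = 0"
  using F_neg by (auto simp: E_def)

lemma vac_E: "vac \<in> E 0 False"
  using word_F[of "[]"] unfolding E_def by auto

lemma L_squares: "L1 p (L1 q v) + L2 p (L2 q v) = sc (1/2) (X False p (X False q v) + X True p (X True q v))"
proof -
  have "X False p (X False q v) + X True p (X True q v)
    = (L1 p (L1 q v) + L2 p (L2 q v)) + (L1 p (L1 q v) + L2 p (L2 q v))"
    by (simp add: X_def L_simps)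
  moreover have "sc (1/2) (x + x) = x" for x
    unfolding scale_right_distrib scale_left_distrib[symmetric] by simp
  ultimately show ?thesis by simp
qed

text \<open>Neither half of \<open>w_modes\<close> preserves parity by itself, so the terms for
  \<open>L1\<close> and \<open>L2\<close> are paired before being estimated. The subtraction
  \<open>k - 4\<close> is on natural numbers; for k \<ge> 4 the weight is N + k - n - 1.\<close>

lemma w_modes_E:
  assumes "v \<in> E N False"
  shows "w_modes sc L1 L2 k n v \<in> E (N + int (k - 4) + 3 - n) False"
proof -
  define j where "j = k - 4"
  define f where "f = (\<lambda>i. nop_term sc Lf1 Lf1 j n v i + nop_term sc Lf2 Lf2 j n v i)"
  have fl: "fld Lf1" "fld Lf2" using FF_base FF_fld by auto
  obtain M1 M2 where M: "\<forall>i\<ge>M1. Lf1 (n + int i) v = 0 \<and> Lf1 (int i) v = 0"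
    "\<forall>i\<ge>M2. Lf2 (n + int i) v = 0 \<and> Lf2 (int i) v = 0"
    using nop_bound[OF fl(1) fl(1)] nop_bound[OF fl(2) fl(2)] by metis
  define M where "M = max M1 M2"
  have LL: "L1 p (L1 q v) + L2 p (L2 q v) \<in> E (N - q - p) False" for p q
  proof -
    have "sc (1/2) (X False p (X False q v) + X True p (X True q v)) \<in> E (N - q - p) False"
      using assms E_X[OF E_X[OF assms, of False q], of False p] E_X[OF E_X[OF assms, of True q], of True p]
      by (intro E_closed) auto
    then show ?thesis by (simp only: L_squares)
  qed
  have "f i \<in> E (N + int j + 3 - n) False" for i
  proof -
    have "f i = sc (of_nat (j + i choose i))
      ((L1 (- int j - 2 - int i) (L1 (n + int i - 1) v) + L2 (- int j - 2 - int i) (L2 (n + int i - 1) v))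
      + sc ((-1)^j) (L1 (n - int j - 2 - int i) (L1 (int i - 1) v) + L2 (n - int j - 2 - int i) (L2 (int i - 1) v)))"
      by (simp add: f_def nop_term_def Lf1_def Lf2_def scale_right_distrib algebra_simps)
    also have "\<dots> \<in> E (N + int j + 3 - n) False"
    proof -
      have 1: "N - (n + int i - 1) - (- int j - 2 - int i) = N + int j + 3 - n"
        and 2: "N - (int i - 1) - (n - int j - 2 - int i) = N + int j + 3 - n" by simp_all
      show ?thesis
        by (intro E_closed(2) E_closed(1)[OF _ E_closed(2)]
            LL[of "- int j - 2 - int i" "n + int i - 1", unfolded 1]
            LL[of "n - int j - 2 - int i" "int i - 1", unfolded 2])
    qed
    finally show ?thesis .
  qed
  moreover have "w_modes sc L1 L2 k n v = (\<Sum>i<M. f i)"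
  proof -
    have "nop sc Lf1 Lf1 j n v = (\<Sum>i<M. nop_term sc Lf1 Lf1 j n v i)"
      by (rule nop_eq_sum[OF fl(1) fl(1)]) (use M in \<open>auto simp: M_def\<close>)
    moreover have "nop sc Lf2 Lf2 j n v = (\<Sum>i<M. nop_term sc Lf2 Lf2 j n v i)"
      by (rule nop_eq_sum[OF fl(2) fl(2)]) (use M in \<open>auto simp: M_def\<close>)
    ultimately show ?thesis
      by (simp add: w_modes_def f_def sum.distrib j_def Lf1_def[abs_def] Lf2_def[abs_def])
  qed
  ultimately show ?thesis by (simp add: E_closed j_def)
qed

lemma FF_w_modes: "FF (w_modes sc L1 L2 k)"
  using FF_add[OF FF_nop[OF FF_base(1,1)] FF_nop[OF FF_base(2,2)], of "k - 4" "k - 4"]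
  by (simp add: w_modes_def[abs_def] Lf1_def[abs_def] Lf2_def[abs_def])

lemma omega_modes_XF: "omega_modes L1 L2 = XF False"
  by (auto simp: omega_modes_def XF_def X_def fun_eq_iff)

end

section \<open>Strong generation from a given set of weighted fields\<close>

text \<open>The set of generators, each with its weight, is a parameter, so that c = 256/47 and all
  other c share one argument.\<close>

locale generating_fields = vir_square sc c vac L1 L2
  for sc :: "complex \<Rightarrow> 'w::ab_group_add \<Rightarrow> 'w" and c vac L1 L2 +
  fixes GW :: "((int \<Rightarrow> 'w \<Rightarrow> 'w) \<times> int) set"
  assumes gen_FF: "(a, h) \<in> GW \<Longrightarrow> FF a"
    and gen_wt: "(a, h) \<in> GW \<Longrightarrow> h > 0"
    and gen_E: "(a, h) \<in> GW \<Longrightarrow> v \<in> E N False \<Longrightarrow> a n v \<in> E (N + h - n - 1) False"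
    and gen_omega: "(XF False, 2) \<in> GW"
begin

definition nm :: "(((int \<Rightarrow> 'w \<Rightarrow> 'w) \<times> int) \<times> nat) list \<Rightarrow> 'w" where
  "nm ps = nmono vac (map (\<lambda>((a, h), j). (a, j)) ps)"

definition wtp :: "(((int \<Rightarrow> 'w \<Rightarrow> 'w) \<times> int) \<times> nat) list \<Rightarrow> int" where
  "wtp ps = (\<Sum>((a, h), j)\<leftarrow>ps. h + int j)"

definition SW :: "int \<Rightarrow> 'w set" where
  "SW N = span {nm ps | ps. fst ` set ps \<subseteq> GW \<and> wtp ps = N}"

definition Y :: "(((int \<Rightarrow> 'w \<Rightarrow> 'w) \<times> int) \<times> nat) list \<Rightarrow> int \<Rightarrow> 'w \<Rightarrow> 'w" where
  "Y ps = foldr (\<lambda>((a, h), j) B. nop sc a B j) ps idf"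

lemma ps_simps [simp]:
  "nm [] = vac" "nm (((a, h), j) # ps) = a (- int j - 1) (nm ps)"
  "wtp [] = 0" "wtp (((a, h), j) # ps) = h + int j + wtp ps"
  "Y [] = idf" "Y (((a, h), j) # ps) = nop sc a (Y ps) j"
  by (simp_all add: nm_def nmono_def wtp_def Y_def)

lemma SW_subspace: "subspace (SW N)"
  by (simp add: SW_def)

lemmas SW_closed = subspace_add[OF SW_subspace] subspace_scale[OF SW_subspace] subspace_0[OF SW_subspace]
  subspace_sum[OF SW_subspace] subspace_diff[OF SW_subspace] subspace_neg[OF SW_subspace]

lemma gen_hom: "(a, h) \<in> GW \<Longrightarrow> module_hom sc sc (a n)"
  using FF_fld[OF gen_FF] by (simp add: fld_def)

lemma vac_SW: "vac \<in> SW 0"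
  unfolding SW_def by (rule span_base) (auto intro!: exI[of _ "[]"])

lemma SW_gen:
  assumes "(a, h) \<in> GW" "v \<in> SW M"
  shows "a (- int j - 1) v \<in> SW (M + h + int j)"
  unfolding SW_def
proof (rule hom_span[OF gen_hom[OF assms(1)]])
  show "v \<in> span {nm ps |ps. fst ` set ps \<subseteq> GW \<and> wtp ps = M}" using assms(2) by (simp add: SW_def)
  fix x assume "x \<in> {nm ps |ps. fst ` set ps \<subseteq> GW \<and> wtp ps = M}"
  then obtain ps where ps: "x = nm ps" "fst ` set ps \<subseteq> GW" "wtp ps = M" by auto
  show "a (- int j - 1) x \<in> span {nm ps |ps. fst ` set ps \<subseteq> GW \<and> wtp ps = M + h + int j}"
    by (intro span_base CollectI exI[of _ "((a, h), j) # ps"]) (use ps assms(1) in auto)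
qed

lemma nm_T:
  assumes "fst ` set ps \<subseteq> GW"
  shows "T (nm ps) \<in> SW (wtp ps + 1)"
  using assms
proof (induction ps)
  case Nil
  then show ?case by (simp add: T_vac SW_closed)
next
  case (Cons p ps)
  obtain a h j where p: "p = ((a, h), j)" by (metis surj_pair)
  have g: "(a, h) \<in> GW" and IH: "T (nm ps) \<in> SW (wtp ps + 1)" using Cons p by auto
  have nm: "nm ps \<in> SW (wtp ps)" unfolding SW_def using Cons.prems by (intro span_base) auto
  have "covariant T a" using FF_good[OF gen_FF[OF g]] by (simp add: good_def)
  then have "T (a n v) = a n (T v) + sc (- of_int n) (a (n - 1) v)" for n v
    unfolding covariant_def by (metis diff_add_cancel add.commute)
  from this[of "- int j - 1" "nm ps"]
  have "T (a (- int j - 1) (nm ps)) = a (- int j - 1) (T (nm ps))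
     + sc (of_int (int j + 1)) (a (- int (Suc j) - 1) (nm ps))"
    by (simp add: algebra_simps)
  moreover have "a (- int j - 1) (T (nm ps)) \<in> SW (wtp ps + 1 + h + int j)"
    by (rule SW_gen[OF g IH])
  moreover have "a (- int (Suc j) - 1) (nm ps) \<in> SW (wtp ps + h + int (Suc j))"
    by (rule SW_gen[OF g nm])
  ultimately show ?case unfolding p ps_simps
    by (auto intro!: SW_closed simp: algebra_simps)
qed

lemma SW_T: "v \<in> SW N \<Longrightarrow> T v \<in> SW (N + 1)"
proof -
  assume v: "v \<in> SW N"
  show ?thesis
    unfolding SW_def
  proof (rule hom_span[OF hom_T])
    show "v \<in> span {nm ps |ps. fst ` set ps \<subseteq> GW \<and> wtp ps = N}" using v by (simp add: SW_def)
    fix x assume "x \<in> {nm ps |ps. fst ` set ps \<subseteq> GW \<and> wtp ps = N}"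
    then show "T x \<in> span {nm ps |ps. fst ` set ps \<subseteq> GW \<and> wtp ps = N + 1}"
      using nm_T by (auto simp: SW_def)
  qed
qed

lemma FF_Y: "fst ` set ps \<subseteq> GW \<Longrightarrow> FF (Y ps)"
proof (induction ps)
  case (Cons p ps)
  then have "FF (Y ps)" "FF (fst (fst p))" using gen_FF[of "fst (fst p)" "snd (fst p)"] by auto
  then show ?case by (cases p) (auto simp: FF_nop)
qed (simp add: FF_base)

lemma Y_vac: "fst ` set ps \<subseteq> GW \<Longrightarrow> Y ps (- 1) vac = nm ps"
proof (induction ps)
  case (Cons p ps)
  obtain a h j where p: "p = ((a, h), j)" by (metis surj_pair)
  have g: "good T vac a" "good T vac (Y ps)" 
    using FF_good[OF gen_FF[of a h]] FF_good[OF FF_Y[of ps]] Cons.prems p by auto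
  have "fst ` set ps \<subseteq> GW" using Cons by auto
  then show ?case using Cons nop_vac[of a "Y ps" vac j] g p by (simp add: good_def)
qed (simp add: idf_def)

lemma Y_E:
  assumes "fst ` set ps \<subseteq> GW" "v \<in> E M False"
  shows "Y ps n v \<in> E (M + wtp ps - n - 1) False"
  using assms
proof (induction ps arbitrary: n M v)
  case Nil
  then show ?case by (auto simp: idf_def E_closed)
next
  case (Cons p ps)
  obtain a h j where p: "p = ((a, h), j)" by (metis surj_pair)
  have g: "(a, h) \<in> GW" and ps: "fst ` set ps \<subseteq> GW" using Cons p by auto
  have "nop_term sc a (Y ps) j n v i \<in> E (M + wtp (p # ps) - n - 1) False" for i
  proof -
    have 1: "a (- int j - 1 - int i) (Y ps (n + int i) v) \<in> E (M + wtp (p # ps) - n - 1) False"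
      using gen_E[OF g Cons.IH[OF ps Cons.prems(2), of "n + int i"], of "- int j - 1 - int i"]
      by (simp add: p algebra_simps)
    have 2: "Y ps (n - int j - 1 - int i) (a (int i) v) \<in> E (M + wtp (p # ps) - n - 1) False"
      using Cons.IH[OF ps gen_E[OF g Cons.prems(2), of "int i"], of "n - int j - 1 - int i"]
      by (simp add: p algebra_simps)
    show ?thesis unfolding nop_term_def by (intro E_closed(2) E_closed(1)[OF 1 E_closed(2)[OF 2]])
  qed
  then show ?case unfolding p ps_simps nop_def by (intro E_closed(4)) (simp add: p)
qed

text \<open>In the first half of the product the inner state has weight below N, as generators have
  positive weight, so \<open>IH\<close> applies and a creating mode of a generator stays in the
  span. In the second half the mode moved onto \<open>Y ps\<close> has m \<ge> 1, and the recursion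
  ends at \<open>idf\<close>, which vanishes there; this is the purpose of the disjunction.\<close>

lemma Y_SW:
  assumes IH: "\<And>M v. M < N \<Longrightarrow> v \<in> E M False \<Longrightarrow> v \<in> SW M"
    and "fst ` set ps \<subseteq> GW" "v \<in> E M False" "ps \<noteq> [] \<or> m \<ge> 1" "wtp ps + int m + M = N"
  shows "Y ps (- int m - 1) v \<in> SW N"
  using assms(2-)
proof (induction ps arbitrary: m M v)
  case Nil
  then show ?case by (auto simp: idf_def SW_closed)
next
  case (Cons p ps)
  obtain a h j where p: "p = ((a, h), j)" by (metis surj_pair)
  have g: "(a, h) \<in> GW" and ps: "fst ` set ps \<subseteq> GW" using Cons p by auto
  have N: "N = h + int j + wtp ps + int m + M" using Cons.prems(4) p by simp
  have "nop_term sc a (Y ps) j (- int m - 1) v i \<in> SW N" for i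
  proof -
    define u where "u = Y ps (- int m - 1 + int i) v"
    have "u \<in> E (N - h - int j - int i) False"
      using Y_E[OF ps Cons.prems(2), of "- int m - 1 + int i"] by (simp add: N u_def algebra_simps)
    then have uS: "u \<in> SW (N - h - int j - int i)" using gen_wt[OF g] by (intro IH) auto
    have 1: "a (- int j - 1 - int i) u \<in> SW N"
    proof -
      have "- int (j + i) - 1 = - int j - 1 - int i" "N - h - int j - int i + h + int (j + i) = N" by simp_all
      then show ?thesis using SW_gen[OF g, of u "N - h - int j - int i" "j + i"] uS by metis
    qed
    have 2: "Y ps (- int m - 1 - int j - 1 - int i) (a (int i) v) \<in> SW N"
    proof -
      have "- int (m + j + 1 + i) - 1 = - int m - 1 - int j - 1 - int i"
        "wtp ps + int (m + j + 1 + i) + (M + h - int i - 1) = N" "m + j + 1 + i \<ge> 1" by (simp_all add: N)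
      then show ?thesis
        using Cons.IH[OF ps gen_E[OF g Cons.prems(2), of "int i"], of "m + j + 1 + i"] by metis
    qed
    show ?thesis unfolding nop_term_def u_def[symmetric]
      by (intro SW_closed(2) SW_closed(1)[OF 1 SW_closed(2)[OF 2]])
  qed
  then show ?case unfolding p ps_simps nop_def by (intro SW_closed(4)) simp
qed

text \<open>\<open>IH\<close> expands the state of C in monomials \<open>nm ps\<close>, with
  \<open>ps\<close> nonempty because P > 0. By uniqueness C is the same combination of the fields
  \<open>Y ps\<close>, to which \<open>Y_SW\<close> applies.\<close>

lemma state_SW:
  assumes IH: "\<And>M v. M < N \<Longrightarrow> v \<in> E M False \<Longrightarrow> v \<in> SW M"
    and C: "FF C" "C (- 1) vac \<in> E P False" "0 < P" "P < N"
    and v: "v \<in> E M False" "P + int m + M = N"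
  shows "C (- int m - 1) v \<in> SW N"
proof -
  \<comment> \<open>Stated for states and not for C itself, so that induction over the span can
    build the field D along with the linear combination.\<close>
  define good_state where "good_state u \<longleftrightarrow> (\<exists>D. FF D \<and> D (- 1) vac = u \<and>
    (\<forall>m M v. v \<in> E M False \<longrightarrow> P + int m + M = N \<longrightarrow> D (- int m - 1) v \<in> SW N))" for u
  have "C (- 1) vac \<in> SW P" using IH C by auto
  then have "good_state (C (- 1) vac)"
    unfolding SW_def
  proof (induction rule: span_induct_alt)
    case base
    show ?case unfolding good_state_def
      using FF_scale[OF FF_base(3), of 0] by (intro exI[of _ "\<lambda>n v. sc 0 (idf n v)"]) (auto simp: SW_closed)
  next
    case (step a x y)
    then obtain ps where ps: "x = nm ps" "fst ` set ps \<subseteq> GW" "wtp ps = P" by auto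
    then have ne: "ps \<noteq> []" using C(3) by auto
    obtain D where D: "FF D" "D (- 1) vac = y"
      "\<And>m M v. v \<in> E M False \<Longrightarrow> P + int m + M = N \<Longrightarrow> D (- int m - 1) v \<in> SW N"
      using step.IH unfolding good_state_def by blast
    show ?case unfolding good_state_def
    proof (intro exI[of _ "\<lambda>n v. sc a (Y ps n v) + D n v"] conjI allI impI)
      show "FF (\<lambda>n v. sc a (Y ps n v) + D n v)" using FF_add[OF FF_scale[OF FF_Y[OF ps(2)]] D(1)] .
      show "sc a (Y ps (- 1) vac) + D (- 1) vac = sc a x + y" using Y_vac[OF ps(2)] ps(1) D(2) by simp
      fix m M v assume v: "v \<in> E M False" "P + int m + M = N"
      have "Y ps (- int m - 1) v \<in> SW N"
        by (rule Y_SW[OF _ ps(2) v(1)]) (use IH ne v(2) ps(3) in auto)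
      then show "sc a (Y ps (- int m - 1) v) + D (- int m - 1) v \<in> SW N"
        using D(3)[OF v] by (intro SW_closed(1,2))
    qed
  qed
  then obtain D where "FF D" "D (- 1) vac = C (- 1) vac"
    "\<And>m M v. v \<in> E M False \<Longrightarrow> P + int m + M = N \<Longrightarrow> D (- int m - 1) v \<in> SW N"
    unfolding good_state_def by blast
  then show ?thesis using FF_unique[OF C(1), of D "- int m - 1" v] v by simp
qed

end

context vir_square
begin

subsection \<open>Quadratic states\<close>

text \<open>The field of the state X True (-a'-2) (X True (-b'-2) vac).\<close>

definition QF :: "nat \<Rightarrow> nat \<Rightarrow> int \<Rightarrow> 'w \<Rightarrow> 'w" where
  "QF a b = nop sc (XF True) (nop sc (XF True) idf b) a"

lemma FF_QF: "FF (QF a b)"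
  unfolding QF_def by (intro FF_nop FF_XF FF_base)

text \<open>Normal ordering with the identity field gives the derivative of x(z) of order b divided
  by b!. In either range of modes \<open>idf\<close> leaves at most one term of the sum.\<close>

lemma derivative_field:
  shows "nop sc (XF True) idf b (int n) v = sc ((-1) ^ b * of_nat (n choose b)) (X True (int n - int b - 1) v)"
    and "nop sc (XF True) idf b (- int n - 1) v = sc (of_nat (b + n choose b)) (X True (- int b - int n - 2) v)"
proof -
  have fl: "fld (XF True)" "fld idf" using FF_XF FF_base FF_fld by auto
  have "nop sc (XF True) idf b (int n) v = nop_term sc (XF True) idf b (int n) v (n - b)" if "b \<le> n"
  proof -
    have "nop_term sc (XF True) idf b (int n) v i = 0" if "i \<noteq> n - b" for i
      using that \<open>b \<le> n\<close> by (auto simp: nop_term_def idf_def fld_0[OF fl(1)])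
    then show ?thesis
      unfolding nop_def by (subst sum.mono_neutral_left[of "{n - b}"]) auto
  qed
  moreover have "nop sc (XF True) idf b (int n) v = 0" if "\<not> b \<le> n"
  proof -
    have "nop_term sc (XF True) idf b (int n) v i = 0" for i
      using that by (auto simp: nop_term_def idf_def fld_0[OF fl(1)])
    then show ?thesis by (simp add: nop_def)
  qed
  ultimately show "nop sc (XF True) idf b (int n) v = sc ((-1) ^ b * of_nat (n choose b)) (X True (int n - int b - 1) v)"
    by (cases "b \<le> n") (auto simp: nop_term_def idf_def X_simps XF_def
        binomial_symmetric[symmetric] algebra_simps)
  have "nop_term sc (XF True) idf b (- int n - 1) v i = 0" if "i \<noteq> n" for i
    using that by (auto simp: nop_term_def idf_def fld_0[OF fl(1)])
  then have "nop sc (XF True) idf b (- int n - 1) v = nop_term sc (XF True) idf b (- int n - 1) v n"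
    unfolding nop_def by (subst sum.mono_neutral_left[of "{n}"]) auto
  then show "nop sc (XF True) idf b (- int n - 1) v = sc (of_nat (b + n choose b)) (X True (- int b - int n - 2) v)"
    using binomial_symmetric[of n "b + n"]
    by (simp add: nop_term_def idf_def XF_def X_simps algebra_simps)
qed

lemma QF_vac: "QF a b (- 1) vac = X True (- int a - 2) (X True (- int b - 2) vac)"
proof -
  have g: "good T vac (XF True)" "good T vac idf" "good T vac (nop sc (XF True) idf b)"
    using FF_good FF_XF FF_base FF_nop by blast+
  have "QF a b (- 1) vac = XF True (- int a - 1) (nop sc (XF True) idf b (- 1) vac)"
    unfolding QF_def using g by (intro nop_vac) (auto simp: good_def)
  then show ?thesis using derivative_field(2)[of b 0 vac] by (simp add: XF_def algebra_simps)
qed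

text \<open>The first product comes from terms in which the second factor of the normally ordered
  product acts by a nonnegative mode, the other from terms in which the first factor does.\<close>

definition qc :: "nat \<Rightarrow> nat \<Rightarrow> nat \<Rightarrow> complex" where
  "qc a b i = (-1) ^ b * of_nat ((a + i + b + 1) choose (i + b + 1)) * of_nat ((i + b) choose b)
     + (-1) ^ a * of_nat ((a + i) choose i) * of_nat ((a + i + b + 1) choose b)"

lemma sum_shift_zero:
  fixes g :: "nat \<Rightarrow> 'b::comm_monoid_add"
  assumes "\<And>i. i < b \<Longrightarrow> g i = 0"
  shows "(\<Sum>i<M + b. g i) = (\<Sum>i<M. g (i + b))"
  by (induction M) (auto simp: assms add_ac)

lemma QF_expand:
  assumes "\<And>i. i \<ge> M \<Longrightarrow> X True (int i - 1) v = 0"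
  shows "QF a b (- 1) v = X True (- int a - 2) (X True (- int b - 2) v)
    + (\<Sum>i<M. sc (qc a b i) (X True (- int a - int b - 3 - int i) (X True (int i - 1) v)))"
proof -
  define B where "B = nop sc (XF True) idf b"
  have fl: "fld (XF True)" "fld B" unfolding B_def using FF_XF FF_base FF_nop FF_fld by blast+
  have B_nonneg: "B (int n) v = sc ((-1) ^ b * of_nat (n choose b)) (X True (int n - int b - 1) v)"
    and B_neg: "B (- int n - 1) v = sc (of_nat (b + n choose b)) (X True (- int b - int n - 2) v)" for n v
    unfolding B_def by (rule derivative_field)+
  define f where "f i = sc (of_nat (a + i choose i)) (XF True (- int a - 1 - int i) (B (- 1 + int i) v))" for i
  define g where "g i = sc (of_nat (a + i choose i) * (-1) ^ a) (B (- 1 - int a - 1 - int i) (XF True (int i) v))" for i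
  have B0: "B (- 1 + int i) v = 0" if "i \<ge> Suc (M + b)" for i
  proof -
    obtain n where n': "i = Suc n" using \<open>i \<ge> Suc (M + b)\<close> by (cases i) auto
    then have n: "i = Suc n" "n \<ge> M + b" using that by auto
    have "X True (int n - int b - 1) v = 0" using assms[of "n - b"] n(2) by (simp add: of_nat_diff)
    then show ?thesis using B_nonneg[of n v] n(1) by simp
  qed
  have x0: "XF True (int i) v = 0" if "i \<ge> M" for i using assms[OF that] by (simp add: XF_def)
  have "QF a b (- 1) v = (\<Sum>i<Suc (M + b). nop_term sc (XF True) B a (- 1) v i)"
    unfolding QF_def B_def[symmetric]
    by (rule nop_eq_sum[OF fl]) (use B0 x0 in auto)
  also have "\<dots> = (\<Sum>i<Suc (M + b). f i) + (\<Sum>i<Suc (M + b). g i)"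
    unfolding f_def g_def sum.distrib[symmetric]
    by (simp add: nop_term_def scale_right_distrib del: sum.lessThan_Suc)
  also have "(\<Sum>i<Suc (M + b). g i) = (\<Sum>i<M. g i)"
    by (rule sum.mono_neutral_right) (auto simp: g_def x0 fld_0[OF fl(2)])
  \<comment> \<open>The modes 0, ..., b - 1 of a derivative of order b vanish, so after the leading
    term 0 the next one is b + 1.\<close>
  also have "(\<Sum>i<Suc (M + b). f i) = f 0 + (\<Sum>i<M. f (Suc (i + b)))"
  proof -
    have "f (Suc i) = 0" if "i < b" for i
      using that B_nonneg[of i v] by (simp add: f_def fld_0[OF fl(1)] binomial_eq_0)
    then show ?thesis unfolding sum.lessThan_Suc_shift by (simp add: sum_shift_zero)
  qed
  also have "f 0 = X True (- int a - 2) (X True (- int b - 2) v)"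
    using B_neg[of 0 v] by (simp add: f_def XF_def algebra_simps)
  finally have *: "QF a b (- 1) v = X True (- int a - 2) (X True (- int b - 2) v)
    + (\<Sum>i<M. f (Suc (i + b))) + (\<Sum>i<M. g i)" .
  have "f (Suc (i + b)) + g i = sc (qc a b i) (X True (- int a - int b - 3 - int i) (X True (int i - 1) v))" for i
  proof -
    have "f (Suc (i + b)) = sc ((-1) ^ b * of_nat ((a + i + b + 1) choose (i + b + 1)) * of_nat ((i + b) choose b))
        (X True (- int a - int b - 3 - int i) (X True (int i - 1) v))"
      using B_nonneg[of "i + b" v] by (simp add: f_def XF_def X_simps algebra_simps)
    moreover have eq: "- int b - int (a + 1 + i) - 2 = - int a - int b - 3 - int i" by simp
    have "g i = sc ((-1) ^ a * of_nat ((a + i) choose i) * of_nat ((a + i + b + 1) choose b))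
        (X True (- int a - int b - 3 - int i) (X True (int i - 1) v))"
      using B_neg[of "a + 1 + i" "X True (int i - 1) v", unfolded eq]
      by (simp add: g_def XF_def algebra_simps)
    ultimately show ?thesis by (simp add: qc_def scale_left_distrib)
  qed
  then show ?thesis unfolding * by (simp add: add.assoc sum.distrib[symmetric])
qed

end

section \<open>Reduction of words to quadratic states\<close>

context generating_fields
begin

lemma SW_omega:
  assumes "v \<in> SW (N - k)" "k \<ge> 2" shows "X False (- k) v \<in> SW N"
  using SW_gen[OF gen_omega assms(1), of "nat (k - 2)"] assms(2) by (simp add: XF_def algebra_simps)

lemma QF_E: "QF a b (- 1) vac \<in> E (int a + int b + 4) False"
  using E_X[OF E_X[OF vac_E, of True "- int b - 2"], of True "- int a - 2"]
  by (simp add: QF_vac algebra_simps)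

text \<open>Moving l to the front leaves a term in which two letters have merged into one. The
  corrections of \<open>QF_expand\<close> apply an annihilating mode and then one creating letter.
  All these words have weight N but length at most k, so the induction on k absorbs them.\<close>

lemma E_SW_step:
  assumes IH: "\<And>M v. M < N \<Longrightarrow> v \<in> E M False \<Longrightarrow> v \<in> SW M"
    and quad: "\<And>a b. 2 \<le> a \<Longrightarrow> 2 \<le> b \<Longrightarrow> a + b = N \<Longrightarrow> X True (- a) (X True (- b) vac) \<in> SW N"
  shows "F k N False \<subseteq> SW N"
proof (induction k)
  case 0
  have "word ls \<in> SW N" if "ls \<in> words 0 N False" for ls
    using that vac_SW by (auto simp: words_def)
  then show ?case unfolding F_def by (intro span_minimal SW_subspace) auto
next
  case (Suc k)
  have "word ls \<in> SW N" if ls: "ls \<in> words (Suc k) N False" for ls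
  proof -
    consider "ls = []" | a l where "ls = (False, a) # l" | a where "ls = [(True, a)]"
      | a b l where "ls = (True, a) # (False, b) # l" | a b l where "ls = (True, a) # (True, b) # l"
      by (metis (full_types) list.exhaust surj_pair)
    then show ?thesis
    proof cases
      case 1
      then show ?thesis using ls vac_SW by (auto simp: words_def)
    next
      case (2 a l)
      then have "word l \<in> F (length l) (N - a) False" "a \<ge> 2"
        using ls word_F[of l] by (auto simp: words_def)
      then have "word l \<in> SW (N - a)" using IH[of "N - a"] by (auto simp: E_def)
      then show ?thesis using SW_omega \<open>a \<ge> 2\<close> 2 by simp
    next
      case (3 a)
      then show ?thesis using ls by (auto simp: words_def)
    next
      case (4 a b l)
      then have l: "word l \<in> F (length l) (N - a - b) True" and ab: "a \<ge> 2" "b \<ge> 2" "Suc (length l) \<le> k"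
        using ls word_F[of l] by (auto simp: words_def algebra_simps)
      have "X True (- a) (word l) \<in> E (N - b) False"
        using E_X[of "word l" "N - a - b" True True "- a"] l by (auto simp: E_def algebra_simps)
      then have 1: "X False (- b) (X True (- a) (word l)) \<in> SW N"
        using IH ab by (intro SW_omega) auto
      have "X True (- a - b) (word l) \<in> F (Suc (length l)) N False"
        using F_create'[of "- a - b" "word l" "length l" "N - a - b" True True] l ab by simp
      then have 2: "X True (- a - b) (word l) \<in> SW N"
        using F_mono[OF ab(3)] Suc.IH by blast
      show ?thesis unfolding 4 word_simps X_comm[of True "- a" False "- b"]
        using 1 2 by (auto intro!: SW_closed)
    next
      case (5 a b l)
      then have l: "word l \<in> F (length l) (N - a - b) False" and ab: "a \<ge> 2" "b \<ge> 2" "Suc (length l) \<le> k"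
        using ls word_F[of l] by (auto simp: words_def algebra_simps)
      show ?thesis
      proof (cases "l = []")
        case True
        then have "a + b = N" using ls 5 by (auto simp: words_def)
        then show ?thesis using quad[of a b] ab 5 True by simp
      next
        case False
        define v where "v = word l"
        define a' b' where "a' = nat (a - 2)" and "b' = nat (b - 2)"
        have a': "int a' = a - 2" "int b' = b - 2" using ab by (auto simp: a'_def b'_def)
        \<comment> \<open>This puts the weight a + b of the quadratic state strictly below N, as
          \<open>state_SW\<close> demands; it fails exactly for empty l.\<close>
        have "N - a - b > 0" 
          using ls 5 False words_wt[of l] by (cases l) (auto simp: words_def)
        then have Q: "QF a' b' (- int 0 - 1) v \<in> SW N"
          using l by (intro state_SW[where P = "a + b" and M = "N - a - b", OF IH FF_QF])
            (use QF_E[of a' b'] a' ab in \<open>auto simp: E_def v_def algebra_simps\<close>)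
        obtain n0 where n0: "\<forall>n\<ge>n0. X True n v = 0" using X_eventually_0 by blast
        define M where "M = nat (n0 + 1)"
        have M: "X True (int i - 1) v = 0" if "i \<ge> M" for i
          using n0 that by (auto simp: M_def)
        have "X True (- int a' - int b' - 3 - int i) (X True (int i - 1) v) \<in> F k N False" for i
        proof -
          have "X True (int i - 1) v \<in> F (length l) (N - a - b - (int i - 1)) (True \<noteq> False)"
            by (rule F_annihilate) (use l v_def in auto)
          moreover have "- int a' - int b' - 3 - int i \<le> -2" by simp
          ultimately
          have "X True (- int a' - int b' - 3 - int i) (X True (int i - 1) v) \<in> F (Suc (length l)) N False"
            using F_create'[of "- int a' - int b' - 3 - int i" "X True (int i - 1) v" "length l" "N - a - b - (int i - 1)" True True]
            by (simp add: a')
          then show ?thesis using F_mono[OF ab(3)] by blast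
        qed
        then have "(\<Sum>i<M. sc (qc a' b' i) (X True (- int a' - int b' - 3 - int i) (X True (int i - 1) v))) \<in> SW N"
          using Suc.IH by (intro SW_closed(2,4)) auto
        moreover have "QF a' b' (- 1) v = X True (- int a' - 2) (X True (- int b' - 2) v)
          + (\<Sum>i<M. sc (qc a' b' i) (X True (- int a' - int b' - 3 - int i) (X True (int i - 1) v)))"
          by (rule QF_expand) (rule M)
        ultimately have "X True (- int a' - 2) (X True (- int b' - 2) v) \<in> SW N"
          using SW_closed(5)[OF Q] by force
        then show ?thesis by (simp add: 5 v_def a')
      qed
    qed
  qed
  then show ?case unfolding F_def by (intro span_minimal SW_subspace) auto
qed

definition qq :: "int \<Rightarrow> 'w" where
  "qq N = X True (2 - N) (X True (- 2) vac)"

text \<open>Congruence of u to t times \<open>qq N\<close> modulo \<open>SW N\<close>. It is a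
  relation because t is determined only if \<open>qq N\<close> lies outside the span; two different
  t for one u put it inside.\<close>

definition cg :: "int \<Rightarrow> 'w \<Rightarrow> complex \<Rightarrow> bool" where
  "cg N u t \<longleftrightarrow> u - sc t (qq N) \<in> SW N"

lemma cg_add: "cg N u s \<Longrightarrow> cg N v t \<Longrightarrow> cg N (u + v) (s + t)"
  using SW_closed(1)[of "u - sc s (qq N)" N "v - sc t (qq N)"]
  by (simp add: cg_def scale_left_distrib algebra_simps)

lemma cg_sc: "cg N u s \<Longrightarrow> cg N (sc a u) (a * s)"
  using SW_closed(2)[of "u - sc s (qq N)" N a]
  by (simp add: cg_def scale_right_diff_distrib)

lemma cg_diff: "cg N u s \<Longrightarrow> cg N v t \<Longrightarrow> cg N (u - v) (s - t)"
  using cg_add[of N u s "sc (-1) v" "-1 * t"] cg_sc[of N v t "-1"] by simp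

lemma cg_SW: "u \<in> SW N \<Longrightarrow> cg N u 0"
  by (simp add: cg_def)

lemma cg_0: "cg N 0 0"
  by (simp add: cg_def SW_closed)

lemma cg_sum: "(\<And>i. i \<in> I \<Longrightarrow> cg N (f i) (g i)) \<Longrightarrow> cg N (sum f I) (sum g I)"
  by (induction I rule: infinite_finite_induct) (auto simp: cg_0 cg_add)

lemma cg_zero_iff: "cg N 0 t \<Longrightarrow> t = 0 \<or> qq N \<in> SW N"
proof -
  assume "cg N 0 t"
  then have "sc (- inverse t) (- sc t (qq N)) \<in> SW N" by (intro SW_closed(2)) (simp add: cg_def)
  then show ?thesis by (cases "t = 0") auto
qed

lemma T_X: "T (X e n v) = X e n (T v) + sc (of_int (-1 - n)) (X e (n - 1) v)"
  using X_comm[of False "-1" e n v] by (cases e) (auto simp: T_def algebra_simps)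

lemma scale_cancel_SW: "sc t u \<in> SW N \<Longrightarrow> t \<noteq> 0 \<Longrightarrow> u \<in> SW N"
  using SW_closed(2)[of "sc t u" N "inverse t"] by simp

definition qv :: "int \<Rightarrow> int \<Rightarrow> complex" where
  "qv N k = (-1) ^ nat k * of_nat (nat (N - 4) choose nat (k - 2))"

text \<open>Modulo SW N, the state x(-s) x(n) x(-a) x(-d) vac with x = X True and s + a + d = N + n is
  val N s n a d times qq N; val1 comes from the commutator [x(n), x(-a)].\<close>

definition val1 :: "int \<Rightarrow> int \<Rightarrow> int \<Rightarrow> int \<Rightarrow> int \<Rightarrow> complex" where
  "val1 N s m d k = (if m \<le> -2 then of_int (- m - s) * qv N d
     else if k \<ge> 2 then of_int (m + d) * qv N k else 0)"

definition val :: "int \<Rightarrow> int \<Rightarrow> int \<Rightarrow> int \<Rightarrow> int \<Rightarrow> complex" where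
  "val N s n a d =
     of_int (n + d) * (if n - d \<le> -2 then of_int (d - n - a) * qv N (a + d - n) + of_int (d - n - s) * qv N a else 0)
     + (if n = d then c / 6 * of_int (n ^ 3 - n) * qv N a else 0)
     + of_int (n + a) * val1 N s (n - a) d (d + a - n)
     + (if n = a then c / 6 * of_int (n ^ 3 - n) * qv N d else 0)"

text \<open>The first term is the bracket [x(-b-2), x(-2)] = -b l(-b-4) that separates the two
  leading words. The bounds 6 and b + 6 come from the weights 4 and b + 4 of the inner states: later
  modes lead to negative weight.\<close>

definition rho :: "int \<Rightarrow> nat \<Rightarrow> nat \<Rightarrow> complex" where
  "rho N t b = of_nat b * of_int (int t - int b - 2) * qv N 2
     + (\<Sum>i<6. qc t b i * val N (int t + int b + 3 + int i) (int i - 1) 2 2)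
     - (\<Sum>i<b + 6. qc t 0 i * val N (int t + 3 + int i) (int i - 1) (int b + 2) 2)"

section \<open>Congruences modulo the span in weight N\<close>

context
  fixes N :: int
  assumes IH: "\<And>M v. M < N \<Longrightarrow> v \<in> E M False \<Longrightarrow> v \<in> SW M"
begin

lemma XX_E: "X e m (X e n vac) \<in> E (- n - m) False"
  using E_X[OF E_X[OF vac_E, of e n], of e m] by simp

text \<open>Write q_b for x(b+2-N) x(-b-2) vac. Translating a quadratic state of weight N - 1 gives
  (b+1) q_(b+1) + (N-4-b) q_b = 0 modulo \<open>SW N\<close>, which the alternating binomial
  coefficients solve from q_0 = \<open>qq N\<close>.\<close>

lemma cg_quadratic_nat:
  assumes "int b + 4 \<le> N"
  shows "cg N (X True (- (N - 2 - int b)) (X True (- (2 + int b)) vac)) ((-1) ^ b * of_nat (nat (N - 4) choose b))"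
  using assms
proof (induction b)
  case 0
  then show ?case by (simp add: cg_def qq_def SW_closed)
next
  case (Suc b)
  define a where "a = N - 3 - int b"
  define L where "L = nat (N - 4)"
  have a: "a \<ge> 2" using Suc.prems by (simp add: a_def)
  have L: "int (L - b) = a - 1" "b \<le> L" using Suc.prems by (auto simp: L_def a_def)
  have IHb: "cg N (X True (- a - 1) (X True (- (2 + int b)) vac)) ((-1) ^ b * of_nat (L choose b))"
    using Suc by (simp add: a_def L_def algebra_simps)
  have "X True (- a) (X True (- (2 + int b)) vac) \<in> SW (N - 1)"
    using XX_E[of True "- a" "- (2 + int b)"] by (intro IH) (auto simp: a_def)
  from SW_T[OF this] have T: "T (X True (- a) (X True (- (2 + int b)) vac)) \<in> SW N" by simp
  have "T (X True (- a) (X True (- (2 + int b)) vac))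
    = sc (of_nat (Suc b)) (X True (- a) (X True (- (2 + int (Suc b))) vac))
      + sc (of_int (a - 1)) (X True (- a - 1) (X True (- (2 + int b)) vac))"
    unfolding T_X by (simp add: T_vac X_simps algebra_simps)
  from cg_diff[OF cg_SW[OF T, unfolded this] cg_sc[OF IHb, of "of_int (a - 1)"]]
  have c0: "cg N (sc (of_nat (Suc b)) (X True (- a) (X True (- (2 + int (Suc b))) vac)))
      (0 - of_int (a - 1) * ((-1) ^ b * of_nat (L choose b)))" by simp
  have eq: "of_int (a - 1) * of_nat (L choose b) = (of_nat (Suc b) * of_nat (L choose Suc b) :: complex)"
  proof -
    have "(L - b) * (L choose b) = Suc b * (L choose Suc b)"
      using binomial_absorb_comp[of L b] binomial_absorption[of b "L"] L(2)
      by (metis Suc_times_binomial_eq binomial_absorption mult.commute times_binomial_minus1_eq)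
    then have "of_nat (L - b) * of_nat (L choose b) = (of_nat (Suc b) * of_nat (L choose Suc b) :: complex)"
      by (metis of_nat_mult)
    then show ?thesis using L(1) by (metis of_int_of_nat_eq)
  qed
  have "0 - A * (s * B) = D * (-1 * s * C)" if "A * B = D * C" for A B C D s :: complex
    using that by algebra
  from this[OF eq] have "cg N (sc (of_nat (Suc b)) (X True (- a) (X True (- (2 + int (Suc b))) vac)))
      (of_nat (Suc b) * ((-1) ^ Suc b * of_nat (L choose Suc b)))"
    using c0 by (simp only: power_Suc)
  from cg_sc[OF this, of "inverse (of_nat (Suc b))"]
  have "cg N (X True (- a) (X True (- (2 + int (Suc b))) vac)) ((-1) ^ Suc b * of_nat (L choose Suc b))"
    by (simp del: of_nat_Suc add: mult.assoc[symmetric])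
  then show ?case by (simp add: a_def L_def algebra_simps)
qed

lemma cg_quadratic:
  assumes "s \<ge> 2" "k \<ge> 2" "s + k = N"
  shows "cg N (X True (- s) (X True (- k) vac)) (qv N k)"
proof -
  define b where "b = nat (k - 2)"
  have b: "k = int b + 2" using assms by (simp add: b_def)
  have "(-1 :: complex) ^ nat k = (-1) ^ b" by (simp add: b nat_add_distrib)
  moreover have "- (N - 2 - int b) = - s" "- (2 + int b) = - k" "int b + 4 \<le> N" "nat (k - 2) = b"
    using assms b by auto
  ultimately show ?thesis using cg_quadratic_nat[of b] unfolding qv_def by metis
qed

lemma cg_XLX:
  assumes "s \<ge> 2" "k \<ge> 2" "d \<ge> 2" "s + k + d = N"
  shows "cg N (X True (- s) (X False (- k) (X True (- d) vac))) (of_int (k - s) * qv N d)"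
proof -
  have "X True (- s) (X True (- d) vac) \<in> SW (- (- d) - (- s))"
    using assms by (intro IH XX_E) auto
  moreover have "- (- d) - (- s) = N - k" using assms by simp
  ultimately have "X True (- s) (X True (- d) vac) \<in> SW (N - k)" by metis
  then have "X False (- k) (X True (- s) (X True (- d) vac)) \<in> SW N"
    using assms by (intro SW_omega)
  moreover have "cg N (X True (- (s + k)) (X True (- d) vac)) (qv N d)"
    by (rule cg_quadratic) (use assms in auto)
  ultimately have "cg N (X False (- k) (X True (- s) (X True (- d) vac))
      + sc (of_int (k - s)) (X True (- (s + k)) (X True (- d) vac))) (0 + of_int (k - s) * qv N d)"
    by (intro cg_add cg_sc cg_SW)
  then show ?thesis unfolding X_comm[of True "- s" False "- k"]
    by (simp add: algebra_simps)
qed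

lemma cg_val1:
  assumes "s \<ge> 2" "d \<ge> 2" "s - m + d = N" "k = d - m"
  shows "cg N (X True (- s) (X False m (X True (- d) vac))) (val1 N s m d k)"
proof (cases "m \<le> -2")
  case True
  then show ?thesis using cg_XLX[of s "- m" d] assms by (simp add: val1_def)
next
  case False
  have *: "X False m (X True (- d) vac) = sc (of_int (m + d)) (X True (- k) vac)"
    using False assms unfolding X_comm[of False m True "- d"] by (simp add: X_vac X_simps)
  show ?thesis
  proof (cases "k \<ge> 2")
    case True
    then show ?thesis using cg_sc[OF cg_quadratic[of s k], of "of_int (m + d)"] assms False
      unfolding * by (simp add: val1_def X_simps)
  next
    case False
    then have "X True (- k) vac = 0" by (intro X_vac) auto
    then show ?thesis unfolding * using False \<open>\<not> m \<le> -2\<close> by (simp add: val1_def X_simps cg_0)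
  qed
qed

text \<open>x(n) is moved right until it kills the vacuum. Each of the two brackets yields a letter
  l and, if the indices match, a central term; the latter are the only source of c.\<close>

lemma cg_val:
  assumes "s \<ge> 2" "n \<ge> -1" "a \<ge> 2" "d \<ge> 2" "s + a + d = N + n"
  shows "cg N (X True (- s) (X True n (X True (- a) (X True (- d) vac)))) (val N s n a d)"
proof -
  have 1: "cg N (X True (- s) (X True (- a) (X False (n - d) vac)))
     (if n - d \<le> -2 then of_int (d - n - a) * qv N (a + d - n) + of_int (d - n - s) * qv N a else 0)"
  proof (cases "n - d \<le> -2")
    case True
    have "X True (- a) (X False (n - d) vac) = sc (of_int (d - n - a)) (X True (- (a + d - n)) vac)
       + X False (- (d - n)) (X True (- a) vac)"
      unfolding X_comm[of True "- a" False "n - d"] by (simp add: algebra_simps)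
    moreover have "cg N (sc (of_int (d - n - a)) (X True (- s) (X True (- (a + d - n)) vac))
      + X True (- s) (X False (- (d - n)) (X True (- a) vac)))
       (of_int (d - n - a) * qv N (a + d - n) + of_int (d - n - s) * qv N a)"
      by (intro cg_add cg_sc cg_quadratic cg_XLX) (use assms True in auto)
    ultimately show ?thesis using True by (simp add: X_simps)
  next
    case False
    then have "X False (n - d) vac = 0" by (intro X_vac) auto
    then show ?thesis using False by (simp add: X_simps cg_0)
  qed
  have 2: "cg N (X True (- s) (X False (n - a) (X True (- d) vac))) (val1 N s (n - a) d (d + a - n))"
    by (rule cg_val1) (use assms in auto)
  have 3: "cg N (if n = d then sc (c / 6 * of_int (n ^ 3 - n)) (X True (- s) (X True (- a) vac)) else 0)
     (if n = d then c / 6 * of_int (n ^ 3 - n) * qv N a else 0)"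
    using assms cg_sc[OF cg_quadratic[of s a], of "c / 6 * of_int (n ^ 3 - n)"] by (auto simp: cg_0)
  have 4: "cg N (if n = a then sc (c / 6 * of_int (n ^ 3 - n)) (X True (- s) (X True (- d) vac)) else 0)
     (if n = a then c / 6 * of_int (n ^ 3 - n) * qv N d else 0)"
    using assms cg_sc[OF cg_quadratic[of s d], of "c / 6 * of_int (n ^ 3 - n)"] by (auto simp: cg_0)
  have x: "X True n vac = 0" by (rule X_vac[OF assms(2)])
  have "X True (- s) (X True n (X True (- a) (X True (- d) vac)))
    = sc (of_int (n + d)) (X True (- s) (X True (- a) (X False (n - d) vac)))
     + (if n = d then sc (c / 6 * of_int (n ^ 3 - n)) (X True (- s) (X True (- a) vac)) else 0)
     + sc (of_int (n + a)) (X True (- s) (X False (n - a) (X True (- d) vac)))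
     + (if n = a then sc (c / 6 * of_int (n ^ 3 - n)) (X True (- s) (X True (- d) vac)) else 0)"
    unfolding X_comm[of True n True "- a"] X_comm[of True n True "- d"]
    by (cases "n = a"; cases "n = d") (use x in \<open>simp_all add: X_simps\<close>)
  then show ?thesis unfolding val_def
    using cg_add[OF cg_add[OF cg_add[OF cg_sc[OF 1, of "of_int (n + d)"] 3] cg_sc[OF 2, of "of_int (n + a)"]] 4]
    by simp
qed

text \<open>The word x(-t-2) x(-b-2) x(-2) x(-2) vac is reached in two ways by normally ordered
  products of quadratic states, and both must lie in the span.\<close>

lemma quartic_relation:
  assumes "N = int t + int b + 8"
  shows "rho N t b = 0 \<or> qq N \<in> SW N"
proof -
  define v1 v2 where "v1 = X True (- 2) (X True (- 2) vac)" and "v2 = X True (- (int b + 2)) (X True (- 2) vac)"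
  have v1E: "v1 \<in> E 4 False" and v2E: "v2 \<in> E (int b + 4) False"
    using XX_E[of True "-2" "-2"] XX_E[of True "- (int b + 2)" "-2"] by (auto simp: v1_def v2_def algebra_simps)
  have "QF t b (- int 0 - 1) v1 \<in> SW N"
    by (rule state_SW[where P = "int t + int b + 4" and M = 4])
      (use IH FF_QF QF_E[of t b] v1E assms in auto)
  then have u1: "QF t b (- 1) v1 \<in> SW N" by simp
  have "QF t 0 (- int 0 - 1) v2 \<in> SW N"
    by (rule state_SW[where P = "int t + 4" and M = "int b + 4"])
      (use IH FF_QF QF_E[of t 0] v2E assms in auto)
  then have u2: "QF t 0 (- 1) v2 \<in> SW N" by simp
  define S1 where "S1 = (\<Sum>i<6. sc (qc t b i) (X True (- int t - int b - 3 - int i) (X True (int i - 1) v1)))"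
  define S2 where "S2 = (\<Sum>i<b + 6. sc (qc t 0 i) (X True (- int t - int 0 - 3 - int i) (X True (int i - 1) v2)))"
  have e1: "QF t b (- 1) v1 = X True (- int t - 2) (X True (- int b - 2) v1) + S1"
    unfolding S1_def
  proof (rule QF_expand)
    fix i :: nat assume "i \<ge> 6"
    then show "X True (int i - 1) v1 = 0" by (intro E_neg[OF _ E_X[OF v1E, of True "int i - 1"]]) simp
  qed
  have e2: "QF t 0 (- 1) v2 = X True (- int t - 2) (X True (- int 0 - 2) v2) + S2"
    unfolding S2_def
  proof (rule QF_expand)
    fix i :: nat assume "i \<ge> b + 6"
    then show "X True (int i - 1) v2 = 0" by (intro E_neg[OF _ E_X[OF v2E, of True "int i - 1"]]) simp
  qed
  have w: "X True (- int b - 2) v1 = X True (- 2) v2 + sc (of_int (- int b)) (X False (- (int b + 4)) (X True (- 2) vac))"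
    unfolding v1_def v2_def X_comm[of True "- int b - 2" True "-2" "X True (-2) vac"] by (simp add: algebra_simps)
  have m: "- (int t + 2) = - int t - 2" "- int 0 - 2 = (- 2 :: int)" by simp_all
  have d: "QF t b (- 1) v1 - QF t 0 (- 1) v2 =
     sc (of_int (- int b)) (X True (- (int t + 2)) (X False (- (int b + 4)) (X True (- 2) vac))) + S1 - S2"
    unfolding e1 e2 w X_simps m by simp
  have c0: "cg N (X True (- (int t + 2)) (X False (- (int b + 4)) (X True (- 2) vac)))
     (of_int (int b + 4 - (int t + 2)) * qv N 2)"
    by (rule cg_XLX) (use assms in auto)
  have c1: "cg N S1 (\<Sum>i<6. qc t b i * val N (int t + int b + 3 + int i) (int i - 1) 2 2)"
    unfolding S1_def
  proof (intro cg_sum cg_sc)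
    fix i
    show "cg N (X True (- int t - int b - 3 - int i) (X True (int i - 1) v1)) (val N (int t + int b + 3 + int i) (int i - 1) 2 2)"
    proof -
      have m: "- int t - int b - 3 - int i = - (int t + int b + 3 + int i)" by simp
      show ?thesis unfolding v1_def m by (rule cg_val) (use assms in auto)
    qed
  qed
  have c2: "cg N S2 (\<Sum>i<b + 6. qc t 0 i * val N (int t + 3 + int i) (int i - 1) (int b + 2) 2)"
    unfolding S2_def
  proof (intro cg_sum cg_sc)
    fix i
    show "cg N (X True (- int t - int 0 - 3 - int i) (X True (int i - 1) v2)) (val N (int t + 3 + int i) (int i - 1) (int b + 2) 2)"
    proof -
      have m: "- int t - int 0 - 3 - int i = - (int t + 3 + int i)" by simp
      show ?thesis unfolding v2_def m by (rule cg_val) (use assms in auto)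
    qed
  qed
  have "cg N (QF t b (- 1) v1 - QF t 0 (- 1) v2) (rho N t b)"
    unfolding d using cg_diff[OF cg_add[OF cg_sc[OF c0, of "of_int (- int b)"] c1] c2]
    by (simp add: rho_def algebra_simps)
  moreover have "cg N (QF t b (- 1) v1 - QF t 0 (- 1) v2) 0"
    using cg_SW[OF SW_closed(5)[OF u1 u2]] .
  ultimately have "cg N 0 (rho N t b)" using cg_diff by fastforce
  then show ?thesis by (rule cg_zero_iff)
qed

text \<open>Exchanging the two letters of q costs only a multiple of l(-N) vac, but for odd N the
  exchanged word has coefficient -1. So q is congruent to -q; for even N the sign is +1 and nothing
  follows.\<close>

lemma qq_odd:
  assumes "odd N" "N \<ge> 4"
  shows "qq N \<in> SW N"
proof -
  define L where "L = nat (N - 4)"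
  have N: "N = int L + 4" using assms by (simp add: L_def)
  have "cg N (X True (- (N - (N - 2))) (X True (- (N - 2)) vac)) (qv N (N - 2))"
    by (rule cg_quadratic) (use assms in auto)
  moreover have "qv N (N - 2) = -1"
    using assms(1) by (simp add: qv_def N nat_add_distrib)
  ultimately have 1: "X True (- 2) (X True (2 - N) vac) + qq N \<in> SW N"
    by (simp add: cg_def)
  have 2: "sc (of_int (4 - N)) (X False (- N) vac) \<in> SW N"
    using vac_SW assms by (intro SW_closed(2) SW_omega) auto
  have "qq N = X True (- 2) (X True (2 - N) vac) + sc (of_int (4 - N)) (X False (- N) vac)"
    using X_comm[of True "2 - N" True "-2" vac] assms(2) by (simp add: qq_def)
  then have "sc 2 (qq N) = (X True (- 2) (X True (2 - N) vac) + qq N) + sc (of_int (4 - N)) (X False (- N) vac)"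
    using scale_left_distrib[of 1 1 "qq N"] by (simp del: of_int_diff)
  then have "sc 2 (qq N) \<in> SW N" using SW_closed(1)[OF 1 2] by simp
  then show ?thesis using scale_cancel_SW[of 2] by simp
qed

end

end

section \<open>Evaluation of the quartic relations\<close>

lemma choose_prod: "of_nat (n choose m) = (\<Prod>i<m. of_nat n - of_nat i) / (fact m :: complex)"
  by (simp add: binomial_gbinomial gbinomial_prod_rev atLeast0LessThan)

context generating_fields
begin

lemma qv_even: "qv (2 * int r + 10) k = (-1) ^ nat k * of_nat ((2 * r + 6) choose nat (k - 2))"
proof -
  have "nat (2 * int r + 10 - 4) = 2 * r + 6" by simp
  then show ?thesis by (simp add: qv_def)
qed

lemma lessThan_numerals:
  "{..<6::nat} = {0,1,2,3,4,5}" "{..<7::nat} = {0,1,2,3,4,5,6}" "{..<8::nat} = {0,1,2,3,4,5,6,7}"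
  "{..<5::nat} = {0,1,2,3,4}" "{..<4::nat} = {0,1,2,3}" "{..<3::nat} = {0,1,2}" "{..<2::nat} = {0,1}"
  by auto

text \<open>Every binomial coefficient has a numeral as lower entry, so \<open>choose_prod\<close>
  makes both sides polynomials in x and c. At x = 0 the last factor is 3 (256 - 47 c), the origin of
  the exceptional central charge.\<close>

lemma rho_1:
  fixes r :: nat
  defines "x \<equiv> of_nat r :: complex"
  shows "15 * rho (2 * int r + 10) (2 * r + 1) 1 = (x + 1) * (x + 2) * (x + 5) *
     (64 * (x + 3) * (x + 4) - c * (2 * x + 3) * (14 * x + 47))"
  by (simp add: rho_def lessThan_numerals del: One_nat_def of_nat_Suc,
      simp add: val_def val1_def qv_even,
      simp add: qc_def choose_prod lessThan_numerals lessThan_Suc fact_numeral x_def[symmetric]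
        del: binomial_Suc_Suc,
      simp add: field_simps)

text \<open>The factor x is why weight 10 receives no second relation; for x \<noteq> 0 this one has
  a root c different from that of \<open>rho_1\<close>.\<close>

lemma rho_2:
  fixes r :: nat
  defines "x \<equiv> of_nat r :: complex"
  shows "90 * rho (2 * int r + 10) (2 * r) 2 = x * (x + 1) * (x + 5) *
     (256 * (x + 2) * (x + 3) * (x + 4) - 5 * c * (2 * x + 1) * (2 * x + 3) * (2 * x + 5))"
  by (simp add: rho_def lessThan_numerals del: One_nat_def of_nat_Suc,
      simp add: val_def val1_def qv_even,
      simp add: qc_def choose_prod lessThan_numerals lessThan_Suc fact_numeral x_def[symmetric]
        del: binomial_Suc_Suc,
      simp add: field_simps)
end

context vir_square
begin

lemma w_modes_vac:
  assumes "k \<ge> 4"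
  shows "w_modes sc L1 L2 k (- 1) vac
    = sc (1/2) (X False (2 - int k) (X False (- 2) vac) + X True (2 - int k) (X True (- 2) vac))"
proof -
  have g: "good T vac Lf1" "good T vac Lf2" by (rule good_Lf)+
  have k: "- int (k - 4) - 1 - 1 = 2 - int k" using assms by (simp add: of_nat_diff)
  have "nop sc Lf1 Lf1 (k - 4) (- 1) vac = L1 (2 - int k) (L1 (- 2) vac)"
    using nop_vac[of Lf1 Lf1 vac "k - 4"] g k by (simp add: good_def Lf1_def)
  moreover have "nop sc Lf2 Lf2 (k - 4) (- 1) vac = L2 (2 - int k) (L2 (- 2) vac)"
    using nop_vac[of Lf2 Lf2 vac "k - 4"] g k by (simp add: good_def Lf2_def)
  ultimately show ?thesis
    by (simp add: w_modes_def Lf1_def[abs_def] Lf2_def[abs_def] L_squares)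
qed

end

section \<open>The induction on the weight\<close>

context generating_fields
begin

lemma qq_generator:
  assumes IH: "\<And>M v. M < int k \<Longrightarrow> v \<in> E M False \<Longrightarrow> v \<in> SW M"
    and k: "k \<ge> 4" and gen: "(w_modes sc L1 L2 k, int k) \<in> GW"
  shows "qq (int k) \<in> SW (int k)"
proof -
  have w: "w_modes sc L1 L2 k (- 1) vac \<in> SW (int k)"
    using SW_gen[OF gen vac_SW, of 0] by simp
  have "X False (- 2) vac \<in> SW 2"
    using SW_omega[of vac 2 2] vac_SW by simp
  then have l: "X False (- (int k - 2)) (X False (- 2) vac) \<in> SW (int k)"
    using k SW_omega[of "X False (- 2) vac" "int k" "int k - 2"] by simp
  have "qq (int k) = sc 2 (w_modes sc L1 L2 k (- 1) vac) - X False (- (int k - 2)) (X False (- 2) vac)"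
    by (simp add: w_modes_vac[OF k] qq_def)
  then show ?thesis using SW_closed(5)[OF SW_closed(2)[OF w, of 2] l] by simp
qed

lemma rho_nonzero:
  assumes "r = 0 \<Longrightarrow> c \<noteq> 256 / 47"
  shows "rho (2 * int r + 10) (2 * r + 1) 1 \<noteq> 0 \<or> rho (2 * int r + 10) (2 * r) 2 \<noteq> 0"
proof (rule ccontr)
  assume "\<not> ?thesis"
  then have rho: "rho (2 * int r + 10) (2 * r + 1) 1 = 0" "rho (2 * int r + 10) (2 * r) 2 = 0" by auto
  define x where "x = (of_nat r :: complex)"
  have nz: "x + 1 \<noteq> 0" "x + 2 \<noteq> 0" "x + 3 \<noteq> 0" "x + 4 \<noteq> 0" "x + 5 \<noteq> 0"
  proof -
    have "of_nat (r + m) \<noteq> (0 :: complex)" if "m > 0" for m using that by (simp del: of_nat_add)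
    from this[of 1] this[of 2] this[of 3] this[of 4] this[of 5]
    show "x + 1 \<noteq> 0" "x + 2 \<noteq> 0" "x + 3 \<noteq> 0" "x + 4 \<noteq> 0" "x + 5 \<noteq> 0" by (simp_all add: x_def add.commute)
  qed
  have 1: "64 * (x + 3) * (x + 4) = c * (2 * x + 3) * (14 * x + 47)"
    using rho_1[of r] rho(1) nz by (simp add: x_def[symmetric])
  show False
  proof (cases "r = 0")
    case True
    then have "c * 141 = 768" using 1 by (simp add: x_def)
    then have "c = 256 / 47" by (simp add: field_simps)
    then show False using assms True by simp
  next
    case False
    then have "x \<noteq> 0" by (simp add: x_def)
    then have 2: "256 * (x + 2) * (x + 3) * (x + 4) = 5 * c * (2 * x + 1) * (2 * x + 3) * (2 * x + 5)"
      using rho_2[of r] rho(2) nz by (simp add: x_def[symmetric])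
    have "(64 * (x + 3) * (x + 4)) * (4 * (x + 2) * (14 * x + 47))
      = (64 * (x + 3) * (x + 4)) * (5 * (2 * x + 1) * (2 * x + 5))"
      using 1 2 by algebra
    then have "4 * (x + 2) * (14 * x + 47) = 5 * (2 * x + 1) * (2 * x + 5)"
      by (rule mult_left_cancel[THEN iffD1, rotated]) (use nz in \<open>simp only: mult_eq_0_iff, simp\<close>)
    \<comment> \<open>With c eliminated, the equation is read over the natural numbers: 56 r^2 + 300
      r + 376 = 20 r^2 + 60 r + 25, where each coefficient is larger on the left.\<close>
    then have "(of_nat (4 * (r + 2) * (14 * r + 47)) :: complex) = of_nat (5 * (2 * r + 1) * (2 * r + 5))"
      by (simp add: x_def add.commute)
    then have "4 * (r + 2) * (14 * r + 47) = 5 * (2 * r + 1) * (2 * r + 5)"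
      by (simp only: of_nat_eq_iff)
    then show False by (simp add: algebra_simps)
  qed
qed

lemma qq_SW:
  assumes IH: "\<And>M v. M < N \<Longrightarrow> v \<in> E M False \<Longrightarrow> v \<in> SW M"
    and gen: "\<And>k. k \<in> {4, 6, 8} \<or> k = 10 \<and> c = 256 / 47 \<Longrightarrow> (w_modes sc L1 L2 k, int k) \<in> GW"
    and "N \<ge> 4"
  shows "qq N \<in> SW N"
proof (cases "odd N")
  case True
  then show ?thesis using qq_odd[of N] IH \<open>N \<ge> 4\<close> by blast
next
  case even: False
  show ?thesis
  proof (cases "N < 10 \<or> N = 10 \<and> c = 256 / 47")
    case True
    define k where "k = nat N"
    have k: "N = int k" "k \<ge> 4" using \<open>N \<ge> 4\<close> by (auto simp: k_def)
    have "k \<in> {4, 6, 8} \<or> k = 10 \<and> c = 256 / 47"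
    proof (cases "k < 10")
      case True
      then have "k \<in> {4, 5, 6, 7, 8, 9}" using k(2) by auto
      then show ?thesis using even k(1) by auto
    qed (use True k in auto)
    from qq_generator[OF _ k(2) gen[OF this]] IH show ?thesis unfolding k(1) by blast
  next
    case False
    define r where "r = nat ((N - 10) div 2)"
    have N: "N = 2 * int r + 10" using even False by (auto simp: r_def)
    have "rho N (2 * r + 1) 1 = 0 \<or> qq N \<in> SW N" "rho N (2 * r) 2 = 0 \<or> qq N \<in> SW N"
      by (rule quartic_relation; use IH N in simp)+
    moreover have "r = 0 \<Longrightarrow> c \<noteq> 256 / 47" using False N by auto
    ultimately show ?thesis using rho_nonzero[of r] N by auto
  qed
qed

lemma E_SW:
  assumes gen: "\<And>k. k \<in> {4, 6, 8} \<or> k = 10 \<and> c = 256 / 47 \<Longrightarrow> (w_modes sc L1 L2 k, int k) \<in> GW"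
  shows "E N False \<subseteq> SW N"
\<comment> \<open>The measure sends all negative weights to 0; there \<open>E_neg\<close> replaces
  the induction hypothesis.\<close>
proof (induction "nat N" arbitrary: N rule: less_induct)
  case less
  have IH: "v \<in> SW M" if "M < N" "v \<in> E M False" for M v
  proof (cases "M < 0")
    case True
    then show ?thesis using E_neg[OF _ that(2)] SW_closed(3) by simp
  next
    case False
    then show ?thesis using less[of M] that by auto
  qed
  have "X True (- a) (X True (- b) vac) \<in> SW N" if ab: "2 \<le> a" "2 \<le> b" "a + b = N" for a b
  proof -
    have "qq N \<in> SW N" by (rule qq_SW) (use IH gen ab in auto)
    moreover have "cg N (X True (- a) (X True (- b) vac)) (qv N b)"
      by (rule cg_quadratic) (use IH ab in auto)
    ultimately have "X True (- a) (X True (- b) vac) - sc (qv N b) (qq N) + sc (qv N b) (qq N) \<in> SW N"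
      unfolding cg_def by (intro SW_closed(1,2))
    then show ?thesis by simp
  qed
  then have "F k N False \<subseteq> SW N" for k by (intro E_SW_step) (use IH in auto)
  then show ?case by (auto simp: E_def)
qed

end

section \<open>Fixed points of the swap\<close>

context vir_square
begin

lemma parity_decomposition: "\<exists>v0 v1. v = v0 + v1 \<and> v0 \<in> span (\<Union>N. E N False) \<and> v1 \<in> span (\<Union>N. E N True)"
proof (induction v rule: W_induct)
  case 1
  show ?case by (rule subspace_sums[OF subspace_span subspace_span])
next
  case 2
  have "vac \<in> span (\<Union>N. E N False)" using vac_E by (intro span_base) auto
  then show ?case using span_zero by (intro exI[of _ vac] exI[of _ 0]) auto
next
  case (3 e n v)
  then obtain v0 v1 where v: "v = v0 + v1" "v0 \<in> span (\<Union>N. E N False)" "v1 \<in> span (\<Union>N. E N True)" by blast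
  have m: "X e n u \<in> span (\<Union>N. E N (e \<noteq> f))" if "u \<in> span (\<Union>N. E N f)" for u f
  proof (rule hom_span[OF hom_X _ that])
    fix x assume "x \<in> (\<Union>N. E N f)"
    then obtain N where "x \<in> E N f" by auto
    from E_X[OF this, of e n] show "X e n x \<in> span (\<Union>N. E N (e \<noteq> f))"
      by (intro span_base) blast
  qed
  show ?case
  proof (cases e)
    case True
    then show ?thesis using m[OF v(2)] m[OF v(3)] v(1)
      by (intro exI[of _ "X e n v1"] exI[of _ "X e n v0"]) (auto simp: X_simps)
  next
    case False
    then show ?thesis using m[OF v(2)] m[OF v(3)] v(1)
      by (intro exI[of _ "X e n v0"] exI[of _ "X e n v1"]) (auto simp: X_simps)
  qed
qed

context
  fixes \<sigma> :: "'w \<Rightarrow> 'w"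
  assumes swap: "swap_of sc vac L1 L2 \<sigma>"
begin

lemma hom_swap: "module_hom sc sc \<sigma>"
  using swap by (simp add: swap_of_def linear_iff_module_hom)

lemmas swap_simps = module_hom.add[OF hom_swap] module_hom.diff[OF hom_swap] module_hom.scale[OF hom_swap]
  module_hom.zero[OF hom_swap] module_hom.sum[OF hom_swap] module_hom.neg[OF hom_swap]

lemma swap_L: "\<sigma> (L1 n v) = L2 n (\<sigma> v)" "\<sigma> (L2 n v) = L1 n (\<sigma> v)" "\<sigma> vac = vac"
  using swap by (auto simp: swap_of_def)

lemma swap_X: "\<sigma> (X e n v) = (if e then - X e n (\<sigma> v) else X e n (\<sigma> v))"
  by (simp add: X_def swap_simps swap_L algebra_simps)

lemma swap_span_E: "v \<in> span (\<Union>N. E N e) \<Longrightarrow> \<sigma> v = (if e then - v else v)"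
proof -
  have w: "\<sigma> (word ls) = (if parity ls then - word ls else word ls)" for ls
    by (induction ls) (auto simp: swap_L swap_X X_simps)
  have sub: "subspace {v. \<sigma> v = (if e then - v else v)}"
    by (rule subspaceI) (auto simp: swap_simps)
  have "F k N e \<subseteq> {v. \<sigma> v = (if e then - v else v)}" for k N
    unfolding F_def by (intro span_minimal sub) (auto simp: words_def w)
  then have "span (\<Union>N. E N e) \<subseteq> {v. \<sigma> v = (if e then - v else v)}"
    unfolding E_def by (intro span_minimal sub UN_least)
  then show "v \<in> span (\<Union>N. E N e) \<Longrightarrow> \<sigma> v = (if e then - v else v)" by blast
qed

lemma fixed_in_span:
  assumes "\<sigma> v = v" shows "v \<in> span (\<Union>N. E N False)"
proof -
  obtain v0 v1 where v: "v = v0 + v1" "v0 \<in> span (\<Union>N. E N False)" "v1 \<in> span (\<Union>N. E N True)"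
    using parity_decomposition by blast
  have "v0 - v1 = v0 + v1"
    using assms swap_span_E[OF v(2)] swap_span_E[OF v(3)] by (simp add: v(1) swap_simps)
  then have "v1 + v1 = 0" by (simp add: algebra_simps)
  then have "sc 2 v1 = 0" using scale_left_distrib[of 1 1 v1] by simp
  then show ?thesis using v by simp
qed

lemma swap_nop:
  shows "\<sigma> (nop sc Lf1 Lf1 j n v) = nop sc Lf2 Lf2 j n (\<sigma> v)"
    and "\<sigma> (nop sc Lf2 Lf2 j n v) = nop sc Lf1 Lf1 j n (\<sigma> v)"
proof -
  have fl: "fld Lf1" "fld Lf2" using FF_base FF_fld by auto
  have Lf: "\<sigma> (Lf1 p u) = Lf2 p (\<sigma> u)" "\<sigma> (Lf2 p u) = Lf1 p (\<sigma> u)" for p u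
    by (simp_all add: Lf1_def Lf2_def swap_L)
  \<comment> \<open>The index sets of nonzero terms on the two sides are replaced by one common
    range, so that the swap can be applied termwise.\<close>
  have *: "\<sigma> (nop sc A A j n v) = nop sc B B j n (\<sigma> v)"
    if AB: "fld A" "fld B" "\<And>p u. \<sigma> (A p u) = B p (\<sigma> u)" for A B
  proof -
    obtain M where M: "\<forall>i\<ge>M. A (n + int i) v = 0 \<and> A (int i) v = 0"
      using nop_bound[OF AB(1,1)] by blast
    have "nop sc A A j n v = (\<Sum>i<M. nop_term sc A A j n v i)"
      by (rule nop_eq_sum[OF AB(1,1)]) (use M in auto)
    moreover have "nop sc B B j n (\<sigma> v) = (\<Sum>i<M. nop_term sc B B j n (\<sigma> v) i)"
      by (rule nop_eq_sum[OF AB(2,2)]) (use M in \<open>auto simp: AB(3)[symmetric] swap_simps\<close>)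
    ultimately show ?thesis by (simp add: swap_simps nop_term_def AB(3))
  qed
  show "\<sigma> (nop sc Lf1 Lf1 j n v) = nop sc Lf2 Lf2 j n (\<sigma> v)"
    by (rule *[OF fl Lf(1)])
  show "\<sigma> (nop sc Lf2 Lf2 j n v) = nop sc Lf1 Lf1 j n (\<sigma> v)"
    by (rule *[OF fl(2,1) Lf(2)])
qed

lemma swap_w_modes: "\<sigma> (w_modes sc L1 L2 k n v) = w_modes sc L1 L2 k n (\<sigma> v)"
  using swap_nop[of "k - 4" n v]
  by (simp add: w_modes_def swap_simps Lf1_def[abs_def] Lf2_def[abs_def] add.commute)

lemma swap_fixed_span:
  assumes "\<And>a n v. a \<in> G \<Longrightarrow> \<sigma> (a n v) = a n (\<sigma> v)"
  shows "span {nmono vac ps | ps. set (map fst ps) \<subseteq> G} \<subseteq> {v. \<sigma> v = v}"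
proof (rule span_minimal)
  show "subspace {v. \<sigma> v = v}" by (rule subspaceI) (auto simp: swap_simps)
  have "\<sigma> (nmono vac ps) = nmono vac ps" if "set (map fst ps) \<subseteq> G" for ps
    using that by (induction ps) (auto simp: nmono_def swap_L assms)
  then show "{nmono vac ps | ps. set (map fst ps) \<subseteq> G} \<subseteq> {v. \<sigma> v = v}" by auto
qed

text \<open>Fixed vectors are sums of even words, which \<open>E_SW\<close> puts into the span;
  conversely monomials are fixed because every generator commutes with the swap.\<close>

lemma orbifold_generated:
  assumes ks: "4 \<in> K" "6 \<in> K" "8 \<in> K" "c = 256 / 47 \<Longrightarrow> 10 \<in> K" "\<forall>k\<in>K. k \<ge> 4"
  shows "strongly_generated_by sc vac {v. \<sigma> v = v} (insert (omega_modes L1 L2) (w_modes sc L1 L2 ` K))"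
proof -
  define G where "G = insert (omega_modes L1 L2) (w_modes sc L1 L2 ` K)"
  define GW where "GW = insert (XF False, 2) ((\<lambda>k. (w_modes sc L1 L2 k, int k)) ` K)"
  interpret generating_fields sc c vac L1 L2 GW
  proof
    fix a h assume ah: "(a, h) \<in> GW"
    then show "FF a" using FF_XF FF_w_modes by (auto simp: GW_def)
    show "h > 0" using ah ks(5) by (auto simp: GW_def)
    fix v N n assume v: "v \<in> E N False"
    show "a n v \<in> E (N + h - n - 1) False"
    proof (cases "a = XF False \<and> h = 2")
      case True
      then show ?thesis using E_X[OF v, of False "n - 1"] by (simp add: XF_def algebra_simps)
    next
      case False
      then obtain k where "k \<in> K" "a = w_modes sc L1 L2 k" "h = int k" using ah by (auto simp: GW_def)
      moreover have "N + int (k - 4) + 3 - n = N + int k - n - 1" using ks(5) \<open>k \<in> K\<close> by auto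
      ultimately show ?thesis using w_modes_E[OF v, of k n] by metis
    qed
  qed (auto simp: GW_def)
  have G: "fst ` GW = G" by (auto simp: G_def GW_def omega_modes_XF image_iff)
  have "SW N \<subseteq> span {nmono vac ps | ps. set (map fst ps) \<subseteq> G}" for N
    unfolding SW_def
  proof (rule span_mono, safe)
    fix ps :: "(((int \<Rightarrow> 'w \<Rightarrow> 'w) \<times> int) \<times> nat) list"
    assume ps: "fst ` set ps \<subseteq> GW"
    have "set (map fst (map (\<lambda>((a, h), j). (a, j)) ps)) \<subseteq> G"
      using ps unfolding G[symmetric] by (force simp: image_iff)
    then show "\<exists>qs. nm ps = nmono vac qs \<and> set (map fst qs) \<subseteq> G" unfolding nm_def by blast
  qed
  moreover have "E N False \<subseteq> SW N" for N
    by (rule E_SW) (use ks in \<open>auto simp: GW_def\<close>)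
  ultimately have "span (\<Union>N. E N False) \<subseteq> span {nmono vac ps | ps. set (map fst ps) \<subseteq> G}"
    by (intro span_minimal subspace_span UN_least) (rule subset_trans)
  then have "{v. \<sigma> v = v} \<subseteq> span {nmono vac ps | ps. set (map fst ps) \<subseteq> G}"
    using fixed_in_span by blast
  moreover have "\<sigma> (a n v) = a n (\<sigma> v)" if "a \<in> G" for a n v
    using that swap_w_modes by (auto simp: G_def omega_modes_def swap_simps swap_L)
  then have "span {nmono vac ps | ps. set (map fst ps) \<subseteq> G} \<subseteq> {v. \<sigma> v = v}"
    by (rule swap_fixed_span)
  ultimately show ?thesis unfolding strongly_generated_by_def G_def[symmetric] by blast
qed

end

end

theorem theorem3p1:
  fixes sc :: "complex \<Rightarrow> 'w::ab_group_add \<Rightarrow> 'w"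
    and c :: complex and vac :: 'w
    and L1 L2 :: "int \<Rightarrow> 'w \<Rightarrow> 'w" and \<sigma> :: "'w \<Rightarrow> 'w"
  assumes "vir_tensor_square sc c vac L1 L2"
    and "swap_of sc vac L1 L2 \<sigma>"
  shows "(c \<noteq> 256 / 47 \<longrightarrow>
            strongly_generated_by sc vac {v. \<sigma> v = v}
              {omega_modes L1 L2, w_modes sc L1 L2 4, w_modes sc L1 L2 6, w_modes sc L1 L2 8})
       \<and> (c = 256 / 47 \<longrightarrow>
            strongly_generated_by sc vac {v. \<sigma> v = v}
              {omega_modes L1 L2, w_modes sc L1 L2 4, w_modes sc L1 L2 6, w_modes sc L1 L2 8,
               w_modes sc L1 L2 10})"
proof -
  interpret vector_space sc using assms(1) by (simp add: vir_tensor_square_def)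
  interpret vir_square sc c vac L1 L2 by unfold_locales (rule assms(1))
  show ?thesis
    using orbifold_generated[OF assms(2), of "{4, 6, 8}"] orbifold_generated[OF assms(2), of "{4, 6, 8, 10}"]
    by auto
qed

end
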